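(* There are fixed procedures $P_1$ and $P_2$ that only use tgds for their constraints (pre- and postconditions) and such that the following problem is undecidable: given an instance $I$ over a schema $S$, is it true that all the instances in $\mathrm{outcomes}_{P_1}(I)$ satisfy the preconditions of $P_2$?
   Context: Fix disjoint countably infinite sets of attribute names (totally ordered), domain values $D$, and relation names. A schema $S$ is a partial function with finite domain from relation names to finite sets of attributes; "$R$ is in $S$" means $S(R)$ is defined. An instance $I$ of $S$ assigns to each $R$ in $S$ a finite set $R^I$ of tuples, i.e. functions $S(R)\to D$ (also written as value lists in attribute order). A named atom $R(A_1:x_1,\dots,A_k:x_k)$ (the $x_i$ are variables) is compatible with $S$ if $\{A_1,\dots,A_k\}\subseteq S(R)$; $(I,\tau)$ satisfies it if some $t\in R^I$ has $t(A_i)=\tau(x_i)$ for all $i$. A conjunctive query (CQ) is $\exists \bar z\,\phi(\bar z,\bar y)$ with $\phi$ a conjunction of named atoms; it is compatible with $S$ if all its atoms are, and $Q(I)$ is its set of answers $\tau(\bar y)$. A total query is a relation name $R$; it is compatible with $S$ if $R$ is in $S$, and its result is the set of all (unnamed) tuples in $R^I$. A tgd is $\forall \bar x(\exists \bar y\,\phi(\bar x,\bar y)\to\exists\bar z\,\psi(\bar x,\bar z))$ and an egd is $\forall \bar x(\exists\bar y\,\phi(\bar x,\bar y)\to x=x')$ with $x,x'\in\bar x$, where $\phi,\psi$ are conjunctions of named atoms. $I\models\Sigma$ means that every CQ in $\Sigma$ is compatible with the schema of $I$ and every dependency in $\Sigma$ holds in $I$ in the usual first-order sense. A structure constraint is $R[\bar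 s]$ ($\bar s$ a tuple of attributes) or $R[*]$; a schema $S$ satisfies $R[\bar s]$ if $R$ is in $S$ and all attributes of $\bar s$ belong to $S(R)$, and satisfies $R[*]$ if $R$ is in $S$. A procedure is $P=(\mathrm{Scope},C_{in},C_{out},Q_{pres})$: $\mathrm{Scope}$ is a set of structure constraints, $C_{in}$ and $C_{out}$ (pre- and postconditions) are sets of constraints, and $Q_{pres}$ is a set of queries (CQs or total queries). $P$ is applicable on $I$ over $S$ if each query in $Q_{pres}$ is compatible with $S$ and $I\models C_{in}$. An instance $I'$ over the same schema $S$ is a possible outcome of applying $P$ to $I$ if (1) $P$ is applicable on $I$; (2) $I'\models C_{out}$; (3) $I$ and $I'$ agree outside the scope: $R^I=R^{I'}$ for every $R$ in $S$ not mentioned in $\mathrm{Scope}$, and for every $T$ in $S$ mentioned in $\mathrm{Scope}$ with $T[*]\notin\mathrm{Scope}$, the projections of $T^I$ and $T^{I'}$ onto the attributes of $S(T)$ not mentioned in any $T[\bar s]\in\mathrm{Scope}$ coincide; (4) $Q(I)\subseteq Q(I')$ for each $Q\in Q_{pres}$. $\mathrm{outcomes}_P(I)$ is the set of all possible outcomes. *)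

theory Defs
  imports Main "HOL-Library.Nat_Bijection"
begin

section \<open>Names, schemas and instances\<close>

text \<open>Three separate types keep the countably infinite sets of attribute names, domain
  values and relation names disjoint.\<close>

datatype attr = Attr (attr_idx: nat)
datatype dval = Val (val_idx: nat)
datatype relname = Rel (rel_idx: nat)

instantiation attr :: linorder
begin

definition less_eq_attr :: "attr \<Rightarrow> attr \<Rightarrow> bool" where
  "A \<le> B \<longleftrightarrow> attr_idx A \<le> attr_idx B"

definition less_attr :: "attr \<Rightarrow> attr \<Rightarrow> bool" where
  "A < B \<longleftrightarrow> attr_idx A < attr_idx B"

instance
  by standard (auto simp: less_eq_attr_def less_attr_def intro: attr.expand)

end

type_synonym schema = "relname \<rightharpoonup> attr set"
type_synonym tup = "attr \<rightharpoonup> dval"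
type_synonym inst = "relname \<Rightarrow> tup set"

definition is_schema :: "schema \<Rightarrow> bool" where
  "is_schema S \<longleftrightarrow> finite (dom S) \<and> (\<forall>X \<in> ran S. finite X)"

text \<open>Relation names outside the schema get the empty set, so that an instance is
  determined by its relations on the schema.\<close>

definition is_instance :: "schema \<Rightarrow> inst \<Rightarrow> bool" where
  "is_instance S I \<longleftrightarrow> is_schema S
     \<and> (\<forall>R \<in> dom S. finite (I R) \<and> (\<forall>t \<in> I R. dom t = the (S R)))
     \<and> (\<forall>R. R \<notin> dom S \<longrightarrow> I R = {})"


section \<open>Queries and dependencies\<close>

type_synonym var = nat

text \<open>\<open>Atom R [(A1, x1), \<dots>, (Ak, xk)]\<close> is the named atom \<open>R(A1:x1, \<dots>, Ak:xk)\<close>.\<close>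

datatype atom = Atom (atom_rel: relname) (atom_args: "(attr \<times> var) list")

definition wf_atom :: "atom \<Rightarrow> bool" where
  "wf_atom a \<longleftrightarrow> distinct (map fst (atom_args a))"

definition atom_vars :: "atom \<Rightarrow> var set" where
  "atom_vars a = snd ` set (atom_args a)"

definition atom_compatible :: "schema \<Rightarrow> atom \<Rightarrow> bool" where
  "atom_compatible S a \<longleftrightarrow>
     (\<exists>X. S (atom_rel a) = Some X \<and> fst ` set (atom_args a) \<subseteq> X)"

definition sat_atom :: "inst \<Rightarrow> (var \<Rightarrow> dval) \<Rightarrow> atom \<Rightarrow> bool" where
  "sat_atom I \<tau> a \<longleftrightarrow>
     (\<exists>t \<in> I (atom_rel a). \<forall>(A, x) \<in> set (atom_args a). t A = Some (\<tau> x))"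

text \<open>\<open>CQ \<phi> ys\<close> is the conjunctive query with answer tuple \<open>ys\<close>; all variables of the
  conjunction \<open>\<phi>\<close> that do not occur in \<open>ys\<close> are existentially quantified.\<close>

datatype cq = CQ (cq_atoms: "atom list") (cq_answer: "var list")

definition wf_cq :: "cq \<Rightarrow> bool" where
  "wf_cq q \<longleftrightarrow> cq_atoms q \<noteq> [] \<and> (\<forall>a \<in> set (cq_atoms q). wf_atom a)
     \<and> set (cq_answer q) \<subseteq> (\<Union>a \<in> set (cq_atoms q). atom_vars a)"

definition cq_compatible :: "schema \<Rightarrow> cq \<Rightarrow> bool" where
  "cq_compatible S q \<longleftrightarrow> (\<forall>a \<in> set (cq_atoms q). atom_compatible S a)"

definition sat_cq :: "inst \<Rightarrow> (var \<Rightarrow> dval) \<Rightarrow> cq \<Rightarrow> bool" where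
  "sat_cq I \<tau> q \<longleftrightarrow>
     (\<exists>\<sigma>. (\<forall>y \<in> set (cq_answer q). \<sigma> y = \<tau> y) \<and> (\<forall>a \<in> set (cq_atoms q). sat_atom I \<sigma> a))"

datatype query = Conj cq | Total relname

fun wf_query :: "query \<Rightarrow> bool" where
  "wf_query (Conj q) \<longleftrightarrow> wf_cq q"
| "wf_query (Total R) \<longleftrightarrow> True"

fun query_compatible :: "schema \<Rightarrow> query \<Rightarrow> bool" where
  "query_compatible S (Conj q) \<longleftrightarrow> cq_compatible S q"
| "query_compatible S (Total R) \<longleftrightarrow> R \<in> dom S"

definition unnamed :: "tup \<Rightarrow> dval list" where
  "unnamed t = map (\<lambda>A. the (t A)) (sorted_list_of_set (dom t))"

fun query_result :: "query \<Rightarrow> inst \<Rightarrow> dval list set" where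
  "query_result (Conj q) I = {map \<tau> (cq_answer q) | \<tau>. sat_cq I \<tau> q}"
| "query_result (Total R) I = unnamed ` I R"

text \<open>\<open>TGD xs \<phi> \<psi>\<close> is the tgd with frontier \<open>xs\<close>, body \<open>\<phi>\<close> and head \<open>\<psi>\<close>; the remaining
  variables of \<open>\<phi>\<close> and of \<open>\<psi>\<close> are quantified separately on either side, even when
  they share a name. \<open>EGD xs \<phi> x x'\<close> has conclusion \<open>x = x'\<close>.\<close>

datatype dependency =
    TGD "var list" "atom list" "atom list"
  | EGD "var list" "atom list" var var

fun is_tgd :: "dependency \<Rightarrow> bool" where
  "is_tgd (TGD xs \<phi> \<psi>) \<longleftrightarrow> True"
| "is_tgd (EGD xs \<phi> x x') \<longleftrightarrow> False"

fun dep_cqs :: "dependency \<Rightarrow> cq set" where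
  "dep_cqs (TGD xs \<phi> \<psi>) = {CQ \<phi> xs, CQ \<psi> xs}"
| "dep_cqs (EGD xs \<phi> x x') = {CQ \<phi> xs}"

fun wf_dep :: "dependency \<Rightarrow> bool" where
  "wf_dep (TGD xs \<phi> \<psi>) \<longleftrightarrow> wf_cq (CQ \<phi> xs) \<and> wf_cq (CQ \<psi> xs)"
| "wf_dep (EGD xs \<phi> x x') \<longleftrightarrow> wf_cq (CQ \<phi> xs) \<and> x \<in> set xs \<and> x' \<in> set xs"

fun dep_holds :: "inst \<Rightarrow> dependency \<Rightarrow> bool" where
  "dep_holds I (TGD xs \<phi> \<psi>) \<longleftrightarrow> (\<forall>\<tau>. sat_cq I \<tau> (CQ \<phi> xs) \<longrightarrow> sat_cq I \<tau> (CQ \<psi> xs))"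
| "dep_holds I (EGD xs \<phi> x x') \<longleftrightarrow> (\<forall>\<tau>. sat_cq I \<tau> (CQ \<phi> xs) \<longrightarrow> \<tau> x = \<tau> x')"

definition models :: "schema \<Rightarrow> inst \<Rightarrow> dependency set \<Rightarrow> bool" where
  "models S I \<Sigma> \<longleftrightarrow> (\<forall>c \<in> \<Sigma>. (\<forall>q \<in> dep_cqs c. cq_compatible S q) \<and> dep_holds I c)"


section \<open>Procedures\<close>

text \<open>\<open>OnAttrs R s\<close> is the structure constraint \<open>R[s]\<close>, and \<open>OnAll R\<close> is \<open>R[*]\<close>.\<close>

datatype structure_constraint =
    OnAttrs (sc_rel: relname) "attr list"
  | OnAll (sc_rel: relname)

record procedure =
  scope :: "structure_constraint set"
  pre :: "dependency set"
  post :: "dependency set"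
  pres :: "query set"

definition wf_procedure :: "procedure \<Rightarrow> bool" where
  "wf_procedure P \<longleftrightarrow>
     finite (scope P) \<and> finite (pre P) \<and> finite (post P) \<and> finite (pres P)
     \<and> (\<forall>c \<in> pre P \<union> post P. wf_dep c) \<and> (\<forall>q \<in> pres P. wf_query q)"

definition only_tgds :: "procedure \<Rightarrow> bool" where
  "only_tgds P \<longleftrightarrow> (\<forall>c \<in> pre P \<union> post P. is_tgd c)"

definition applicable :: "procedure \<Rightarrow> schema \<Rightarrow> inst \<Rightarrow> bool" where
  "applicable P S I \<longleftrightarrow> (\<forall>q \<in> pres P. query_compatible S q) \<and> models S I (pre P)"

definition scope_attrs :: "structure_constraint set \<Rightarrow> relname \<Rightarrow> attr set" where
  "scope_attrs C T = {A. \<exists>s. OnAttrs T s \<in> C \<and> A \<in> set s}"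

definition project :: "attr set \<Rightarrow> tup set \<Rightarrow> tup set" where
  "project X r = (\<lambda>t. t |` X) ` r"

definition agree_outside_scope ::
  "structure_constraint set \<Rightarrow> schema \<Rightarrow> inst \<Rightarrow> inst \<Rightarrow> bool" where
  "agree_outside_scope C S I I' \<longleftrightarrow>
     (\<forall>R \<in> dom S. R \<notin> sc_rel ` C \<longrightarrow> I R = I' R)
     \<and> (\<forall>T \<in> dom S. T \<in> sc_rel ` C \<and> OnAll T \<notin> C \<longrightarrow>
          project (the (S T) - scope_attrs C T) (I T)
            = project (the (S T) - scope_attrs C T) (I' T))"

definition outcomes :: "procedure \<Rightarrow> schema \<Rightarrow> inst \<Rightarrow> inst set" where
  "outcomes P S I = {I'. is_instance S I'
     \<and> applicable P S I
     \<and> models S I' (post P)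
     \<and> agree_outside_scope (scope P) S I I'
     \<and> (\<forall>q \<in> pres P. query_result q I \<subseteq> query_result q I')}"


section \<open>Decidability\<close>

text \<open>Kleene's partial recursive functions. Programs carry no arity: the argument list
  determines it. \<open>Comp f gs\<close> is composition, \<open>PrimRec f g\<close> is primitive recursion on the
  first argument, with base function \<open>f\<close> and with \<open>g\<close> receiving the predecessor, the
  previous value and the parameters, and \<open>Mu f\<close> is unbounded minimisation over the
  first argument.\<close>

datatype recf =
    Zero
  | Succ
  | Proj nat
  | Comp recf "recf list"
  | PrimRec recf recf
  | Mu recf

text \<open>\<open>rec_eval f xs y\<close>: the program \<open>f\<close> halts on the arguments \<open>xs\<close> with result \<open>y\<close>.\<close>

inductive rec_eval :: "recf \<Rightarrow> nat list \<Rightarrow> nat \<Rightarrow> bool" where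
  zero: "rec_eval Zero xs 0"
| succ: "rec_eval Succ [x] (Suc x)"
| proj: "i < length xs \<Longrightarrow> rec_eval (Proj i) xs (xs ! i)"
| comp: "list_all2 (\<lambda>g y. rec_eval g xs y) gs ys \<Longrightarrow> rec_eval f ys z
    \<Longrightarrow> rec_eval (Comp f gs) xs z"
| prim_0: "rec_eval f xs z \<Longrightarrow> rec_eval (PrimRec f g) (0 # xs) z"
| prim_Suc: "rec_eval (PrimRec f g) (n # xs) r \<Longrightarrow> rec_eval g (n # r # xs) z
    \<Longrightarrow> rec_eval (PrimRec f g) (Suc n # xs) z"
| mu: "rec_eval f (n # xs) 0 \<Longrightarrow> (\<And>i. i < n \<Longrightarrow> \<exists>y. rec_eval f (i # xs) (Suc y))
    \<Longrightarrow> rec_eval (Mu f) xs n"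

text \<open>A decision problem is a set \<open>X\<close> of inputs with a property \<open>Q\<close>; \<open>code\<close> is the
  (injective) representation of inputs by numbers. A decider has to halt with the
  correct answer on all codes of inputs and is unconstrained on other numbers.\<close>

definition decidable_problem :: "('a \<Rightarrow> nat) \<Rightarrow> 'a set \<Rightarrow> ('a \<Rightarrow> bool) \<Rightarrow> bool" where
  "decidable_problem code X Q \<longleftrightarrow>
     (\<exists>f. \<forall>x \<in> X. rec_eval f [code x] (if Q x then 1 else 0))"

text \<open>Schemas and instances are finite objects; they are coded canonically through the
  library bijections between numbers and, respectively, pairs and finite sets of numbers.\<close>

definition tuple_code :: "tup \<Rightarrow> nat" where
  "tuple_code t = set_encode ((\<lambda>A. prod_encode (attr_idx A, val_idx (the (t A)))) ` dom t)"

definition schema_code :: "schema \<Rightarrow> nat" where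
  "schema_code S =
     set_encode ((\<lambda>R. prod_encode (rel_idx R, set_encode (attr_idx ` the (S R)))) ` dom S)"

definition inst_code :: "inst \<Rightarrow> nat" where
  "inst_code I = set_encode {prod_encode (rel_idx R, tuple_code t) | R t. t \<in> I R}"

fun input_code :: "schema \<times> inst \<Rightarrow> nat" where
  "input_code (S, I) = prod_encode (schema_code S, inst_code I)"

definition inputs :: "(schema \<times> inst) set" where
  "inputs = {(S, I). is_instance S I}"

lemma tuple_code_inj:
  assumes "finite (dom t)" "finite (dom u)" "tuple_code t = tuple_code u"
  shows "t = u"
proof -
  have sub: "v A = Some d \<Longrightarrow> w A = Some d"
    if eq: "(\<lambda>A. prod_encode (attr_idx A, val_idx (the (v A)))) ` dom v
      = (\<lambda>A. prod_encode (attr_idx A, val_idx (the (w A)))) ` dom w" for v w :: tup and A d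
  proof -
    assume v: "v A = Some d"
    then have "prod_encode (attr_idx A, val_idx d)
        \<in> (\<lambda>A. prod_encode (attr_idx A, val_idx (the (v A)))) ` dom v"
      by (intro image_eqI[where x = A]) auto
    then have "prod_encode (attr_idx A, val_idx d)
        \<in> (\<lambda>A. prod_encode (attr_idx A, val_idx (the (w A)))) ` dom w"
      using eq by simp
    then obtain B e where B: "w B = Some e" "attr_idx A = attr_idx B" "val_idx d = val_idx e"
      by auto
    have "A = B" "d = e"
      using B(2,3) by (auto intro: attr.expand dval.expand)
    then show "w A = Some d" using B(1) by simp
  qed
  have eq: "(\<lambda>A. prod_encode (attr_idx A, val_idx (the (t A)))) ` dom t
      = (\<lambda>A. prod_encode (attr_idx A, val_idx (the (u A)))) ` dom u"
    using assms unfolding tuple_code_def by (intro set_encode_eq[THEN iffD1]) auto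
  have "t A = u A" for A
    using sub[OF eq, of A] sub[OF eq[symmetric], of A]
    by (cases "t A"; cases "u A") auto
  then show ?thesis by (rule ext)
qed

lemma schema_code_inj:
  assumes "is_schema S" "is_schema S'" "schema_code S = schema_code S'"
  shows "S = S'"
proof -
  let ?F = "\<lambda>(S::schema) R. prod_encode (rel_idx R, set_encode (attr_idx ` the (S R)))"
  have inj: "inj attr_idx" by (simp add: attr.expand inj_def)
  have sub: "v R = Some X \<Longrightarrow> w R = Some X"
    if eq: "?F v ` dom v = ?F w ` dom w" and fin: "is_schema v" "is_schema w"
    for v w :: schema and R X
  proof -
    assume v: "v R = Some X"
    then have "prod_encode (rel_idx R, set_encode (attr_idx ` X)) \<in> ?F v ` dom v"
      by (intro image_eqI[where x = R]) auto
    then have "prod_encode (rel_idx R, set_encode (attr_idx ` X)) \<in> ?F w ` dom w"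
      using eq by simp
    then obtain R' Y where w: "w R' = Some Y" "rel_idx R = rel_idx R'"
        "set_encode (attr_idx ` X) = set_encode (attr_idx ` Y)"
      by auto
    have "finite X" "finite Y"
      using fin v w by (auto simp: is_schema_def ran_def)
    then have "attr_idx ` X = attr_idx ` Y"
      using w(3) by (simp add: set_encode_eq)
    then have "X = Y" using inj by (simp add: inj_image_eq_iff)
    moreover have "R = R'" using w(2) by (rule relname.expand)
    ultimately show "w R = Some X" using w(1) by simp
  qed
  have eq: "?F S ` dom S = ?F S' ` dom S'"
    using assms unfolding schema_code_def is_schema_def
    by (intro set_encode_eq[THEN iffD1]) auto
  have "S R = S' R" for R
    using sub[OF eq assms(1,2), of R] sub[OF eq[symmetric] assms(2,1), of R]
    by (cases "S R"; cases "S' R") auto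
  then show ?thesis by (rule ext)
qed

lemma inst_code_inj:
  assumes "is_instance S I" "is_instance S' I'" "inst_code I = inst_code I'"
  shows "I = I'"
proof -
  let ?F = "\<lambda>I::inst. {prod_encode (rel_idx R, tuple_code t) | R t. t \<in> I R}"
  have dom: "finite (dom t)" if "is_instance S I" "t \<in> I R" for S I R t
  proof -
    have R: "R \<in> dom S"
      using that by (metis is_instance_def empty_iff)
    then obtain X where X: "S R = Some X" by blast
    have "dom t = the (S R)"
      using that R unfolding is_instance_def by metis
    moreover have "finite X"
      using that(1) ranI[of S R X, OF X] by (simp add: is_instance_def is_schema_def)
    ultimately show ?thesis using X by simp
  qed
  have fin: "finite (?F I)" if "is_instance S I" for S I
  proof -
    have d: "finite (dom S)" "\<And>R. R \<in> dom S \<Longrightarrow> finite (I R)"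
      "\<And>R. R \<notin> dom S \<Longrightarrow> I R = {}"
      using that by (simp_all add: is_instance_def is_schema_def)
    have "?F I \<subseteq> (\<Union>R \<in> dom S. (\<lambda>t. prod_encode (rel_idx R, tuple_code t)) ` I R)"
    proof
      fix n assume "n \<in> ?F I"
      then obtain R t where "t \<in> I R" "n = prod_encode (rel_idx R, tuple_code t)" by blast
      moreover from this d(3)[of R] have "R \<in> dom S" by (metis empty_iff)
      ultimately show "n \<in> (\<Union>R \<in> dom S. (\<lambda>t. prod_encode (rel_idx R, tuple_code t)) ` I R)"
        by (intro UN_I[where a = R] image_eqI[where x = t])
    qed
    moreover have "finite (\<Union>R \<in> dom S. (\<lambda>t. prod_encode (rel_idx R, tuple_code t)) ` I R)"
      using d by (intro finite_UN_I finite_imageI)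
    ultimately show ?thesis by (rule finite_subset)
  qed
  have sub: "t \<in> w R"
    if eq: "?F v = ?F w" and v: "is_instance T v" and w: "is_instance T' w" and t: "t \<in> v R"
    for v w :: inst and T T' R t
  proof -
    have "prod_encode (rel_idx R, tuple_code t) \<in> ?F v"
      using t by blast
    then have "prod_encode (rel_idx R, tuple_code t) \<in> ?F w"
      by (simp only: eq)
    then obtain R' u where u: "u \<in> w R'" "rel_idx R = rel_idx R'" "tuple_code t = tuple_code u"
      by auto
    have "t = u"
      using tuple_code_inj[OF dom[OF v t] dom[OF w u(1)] u(3)] .
    moreover have "R = R'" using u(2) by (rule relname.expand)
    ultimately show ?thesis using u(1) by simp
  qed
  have eq: "?F I = ?F I'"
    using assms(3) set_encode_eq[OF fin[OF assms(1)] fin[OF assms(2)]]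
    by (simp add: inst_code_def)
  have "I R = I' R" for R
    using sub[OF eq assms(1,2), of _ R] sub[OF eq[symmetric] assms(2,1), of _ R] by blast
  then show ?thesis by (rule ext)
qed

lemma input_code_inj: "inj_on input_code inputs"
proof (rule inj_onI)
  fix p q assume pq: "p \<in> inputs" "q \<in> inputs" and eq: "input_code p = input_code q"
  obtain S I S' I' where [simp]: "p = (S, I)" "q = (S', I')" by (cases p, cases q)
  have inst: "is_instance S I" "is_instance S' I'"
    using pq by (auto simp: inputs_def)
  then have "is_schema S" "is_schema S'" by (auto simp: is_instance_def)
  with inst eq show "p = q"
    using schema_code_inj[of S S'] inst_code_inj[of S I S' I'] by simp
qed

end

theory Submission
  imports Defs "HOL-Library.Countable"
begin

text \<open>A fixed set of tgds interprets programs of \<open>recf\<close>. An instance stores the syntax tree of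
  a program \<open>p\<close> and a successor chain of length \<open>m\<close>. The tgds request a value of \<open>p\<close> on \<open>m\<close>,
  and every request spawns requests for the premises of the corresponding evaluation rule,
  which are smaller in a transitive relation. A relation that is empty and outside the scope
  turns tgds into denial constraints, so the order is irreflexive and hence well-founded on
  a finite instance. Therefore an outcome exists exactly if \<open>p\<close> halts on \<open>m\<close>. The second
  procedure requires this empty relation to be nonempty, so its precondition follows exactly
  if there is no outcome. For undecidability no universal program is needed: from a decider
  one obtains a program \<open>D\<close> that halts on \<open>m\<close> iff the program whose stored syntax tree has
  code \<open>m\<close> does not halt on \<open>m\<close>; only the code of the chain of length \<open>m\<close> has to be
  computed. Running \<open>D\<close> on its own code is contradictory.\<close>

section \<open>Recursive functions\<close>

inductive_simps rec_eval_simps: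
  "rec_eval Zero xs z" "rec_eval Succ xs z" "rec_eval (Proj i) xs z"
  "rec_eval (Comp f gs) xs z" "rec_eval (PrimRec f g) (0 # xs) z"
  "rec_eval (PrimRec f g) (Suc n # xs) z" "rec_eval (Mu f) xs z"

text \<open>Induction on the first derivation. For \<open>Mu\<close>, two different results would
  give the minimised program both the value 0 and a positive value at the smaller of them.\<close>

lemma rec_eval_det: "rec_eval f xs y \<Longrightarrow> rec_eval f xs z \<Longrightarrow> y = z"
proof (induction arbitrary: z rule: rec_eval.induct)
  case (comp xs gs ys f y)
  from comp.prems obtain zs where zs: "list_all2 (\<lambda>g. rec_eval g xs) gs zs" "rec_eval f zs z"
    unfolding rec_eval_simps by auto
  have "ys = zs"
    using comp.IH(1) zs(1)
    by (intro list_eq_iff_nth_eq[THEN iffD2]) (auto simp: list_all2_conv_all_nth)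
  then show ?case using comp.IH(2) zs(2) by blast
next
  case (prim_Suc f g n xs r y)
  from prim_Suc.prems obtain s where "rec_eval (PrimRec f g) (n # xs) s" "rec_eval g (n # s # xs) z"
    unfolding rec_eval_simps by auto
  then show ?case using prim_Suc.IH by metis
next
  case (mu f n xs)
  from mu.prems have z: "rec_eval f (z # xs) 0" "\<And>i. i < z \<Longrightarrow> \<exists>y. rec_eval f (i # xs) (Suc y)"
    unfolding rec_eval_simps by auto
  show ?case
  proof (rule linorder_cases[of n z])
    assume "n < z" then show ?thesis using z(2) mu.IH(1) by fastforce
  next
    assume "z < n" then show ?thesis using z(1) mu.IH(2) by fastforce
  qed
next
  case (prim_0 f xs y g)
  then show ?case unfolding rec_eval_simps by blast
next
  case (zero xs) then show ?case unfolding rec_eval_simps by blast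
next
  case (succ x) then show ?case unfolding rec_eval_simps by blast
next
  case (proj i xs) then show ?case unfolding rec_eval_simps by blast
qed

section \<open>Closure properties of computable functions\<close>

definition computable :: "(nat \<Rightarrow> nat) \<Rightarrow> bool" where
  "computable h \<longleftrightarrow> (\<exists>f. \<forall>x. rec_eval f [x] (h x))"

lemma rec_eval_Comp1: "rec_eval g xs y \<Longrightarrow> rec_eval f [y] z \<Longrightarrow> rec_eval (Comp f [g]) xs z"
  by (rule rec_eval.comp[where ys = "[y]"]) auto

lemma rec_eval_Comp2:
  "rec_eval g xs y \<Longrightarrow> rec_eval h xs y' \<Longrightarrow> rec_eval f [y, y'] z \<Longrightarrow> rec_eval (Comp f [g, h]) xs z"
  by (rule rec_eval.comp[where ys = "[y, y']"]) auto

lemma rec_eval_Proj: "i < length xs \<Longrightarrow> xs ! i = y \<Longrightarrow> rec_eval (Proj i) xs y"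
  using rec_eval.proj by blast

lemma computable_id: "computable (\<lambda>x. x)"
  unfolding computable_def by (rule exI[of _ "Proj 0"]) (simp add: rec_eval_Proj)

lemma computable_comp: "computable g \<Longrightarrow> computable h \<Longrightarrow> computable (\<lambda>x. g (h x))"
proof -
  assume "computable g" "computable h"
  then obtain p q where "\<And>x. rec_eval p [x] (g x)" "\<And>x. rec_eval q [x] (h x)"
    unfolding computable_def by blast
  then have "\<forall>x. rec_eval (Comp p [q]) [x] (g (h x))" by (blast intro: rec_eval_Comp1)
  then show ?thesis unfolding computable_def by blast
qed

lemma computable_Suc: "computable h \<Longrightarrow> computable (\<lambda>x. Suc (h x))"
  by (rule computable_comp[of Suc]) (unfold computable_def, rule exI[of _ Succ], simp add: rec_eval.succ)

lemma computable_const: "computable (\<lambda>x. c)"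
proof (induction c)
  case 0 show ?case unfolding computable_def by (rule exI[of _ Zero]) (simp add: rec_eval.zero)
qed (rule computable_Suc)

definition add_prog :: recf where
  "add_prog = PrimRec (Proj 0) (Comp Succ [Proj 1])"

lemma rec_eval_add_prog: "rec_eval add_prog [x, y] (x + y)"
  unfolding add_prog_def
proof (induction x)
  case 0 show ?case by (auto intro!: rec_eval.prim_0 rec_eval_Proj)
next
  case (Suc x)
  show ?case
    by (rule rec_eval.prim_Suc[OF Suc])
      (auto intro!: rec_eval_Comp1[where y = "x + y"] rec_eval_Proj rec_eval.succ)
qed

lemma computable_add: "computable g \<Longrightarrow> computable h \<Longrightarrow> computable (\<lambda>x. g x + h x)"
proof -
  assume "computable g" "computable h"
  then obtain p q where "\<And>x. rec_eval p [x] (g x)" "\<And>x. rec_eval q [x] (h x)"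
    unfolding computable_def by blast
  then have "\<forall>x. rec_eval (Comp add_prog [p, q]) [x] (g x + h x)"
    by (blast intro: rec_eval_Comp2 rec_eval_add_prog)
  then show ?thesis unfolding computable_def by blast
qed

text \<open>Codes of finite sets are sums of powers of two, so bounded sums and, below, powers of
  two are the closure properties that make codes of instances computable.\<close>

lemma computable_sum:
  assumes "computable g" shows "computable (\<lambda>n. \<Sum>i<n. g i)"
proof -
  from assms obtain p where p: "\<And>x. rec_eval p [x] (g x)" unfolding computable_def by blast
  have "rec_eval (PrimRec Zero (Comp add_prog [Proj 1, Comp p [Proj 0]])) [n] (\<Sum>i<n. g i)" for n
  proof (induction n)
    case 0 show ?case by (auto intro!: rec_eval.prim_0 rec_eval.zero)
  next
    case (Suc n)
    show ?case
      using rec_eval_add_prog[of "\<Sum>i<n. g i" "g n"]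
      by (intro rec_eval.prim_Suc[OF Suc])
        (auto intro!: rec_eval_Comp2[where y = "\<Sum>i<n. g i" and y' = "g n"]
          rec_eval_Comp1[where y = n] rec_eval_Proj p)
  qed
  then show ?thesis unfolding computable_def by blast
qed

lemma computable_pow2:
  assumes "computable h" shows "computable (\<lambda>x. 2 ^ h x)"
proof (rule computable_comp[OF _ assms])
  have "rec_eval (PrimRec (Comp Succ [Zero]) (Comp add_prog [Proj 1, Proj 1])) [n] (2 ^ n)" for n
  proof (induction n)
    case 0 show ?case
      using rec_eval.succ[of 0]
      by (auto intro!: rec_eval.prim_0 rec_eval_Comp1[where y = 0] rec_eval.zero)
  next
    case (Suc n)
    show ?case
      using rec_eval_add_prog[of "2 ^ n" "2 ^ n"]
      by (intro rec_eval.prim_Suc[OF Suc])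
        (auto simp: mult_2 intro!: rec_eval_Comp2[where y = "2 ^ n" and y' = "2 ^ n"] rec_eval_Proj)
  qed
  then show "computable (\<lambda>n. 2 ^ n)" unfolding computable_def by blast
qed

text \<open>Triangular numbers occur in \<open>prod_encode\<close>; written without division they
  fall under bounded sums.\<close>

lemma triangle_eq_sum: "triangle n = (\<Sum>i<n. Suc i)"
  by (induction n) auto

lemma computable_prod_encode:
  assumes "computable g" "computable h" shows "computable (\<lambda>x. prod_encode (g x, h x))"
proof -
  have "computable triangle"
    unfolding triangle_eq_sum by (intro computable_sum computable_Suc computable_id)
  from computable_comp[OF this computable_add[OF assms]] show ?thesis
    unfolding prod_encode_def prod.case by (rule computable_add[OF _ assms(1)])
qed

text \<open>For a presumed decider \<open>f\<close>, this turns its answer into halting behaviour: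
  \<open>D\<close> computes the answer on \<open>h m\<close> and searches forever if it is
  0.\<close>

lemma diagonal_program:
  assumes "computable h"
  obtains D where "\<And>m. rec_eval f [h m] 1 \<Longrightarrow> \<exists>y. rec_eval D [m] y"
    and "\<And>m. rec_eval f [h m] 0 \<Longrightarrow> \<not> (\<exists>y. rec_eval D [m] y)"
proof -
  from assms obtain H where H: "\<And>m. rec_eval H [m] (h m)" unfolding computable_def by blast
  \<comment> \<open>\<open>Mu B\<close> searches for an argument \<open>i\<close> of \<open>B\<close>, but \<open>B\<close> ignores \<open>i\<close>.\<close>
  define flip where "flip = PrimRec (Comp Succ [Zero]) Zero"
  define B where "B = Comp flip [Comp f [Comp H [Proj 1]]]"
  have flip: "rec_eval flip [0] 1" "rec_eval flip [1] 0"
  proof -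
    show *: "rec_eval flip [0] 1" unfolding flip_def
      using rec_eval.succ[of 0]
      by (auto intro!: rec_eval.prim_0 rec_eval_Comp1[where y = 0] rec_eval.zero)
    show "rec_eval flip [1] 0"
      using rec_eval.prim_Suc[OF *[unfolded flip_def] rec_eval.zero] by (simp add: flip_def)
  qed
  have B: "rec_eval B [i, m] z" if "rec_eval f [h m] y" "rec_eval flip [y] z" for i m y z
    unfolding B_def by (rule rec_eval_Comp1 rec_eval_Proj that H | simp)+
  show ?thesis
  proof (rule that[of "Mu B"])
    fix m assume "rec_eval f [h m] 1"
    \<comment> \<open>The value of \<open>B\<close> is 0 already at index 0, so the search stops at
      once.\<close>
    then have "rec_eval (Mu B) [m] 0" by (intro rec_eval.mu B[OF _ flip(2)]) auto
    then show "\<exists>y. rec_eval (Mu B) [m] y" by blast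
  next
    fix m assume "rec_eval f [h m] 0"
    then have "rec_eval B [i, m] 1" for i by (rule B[OF _ flip(1)])
    moreover have "\<exists>i. rec_eval B [i, m] 0" if "rec_eval (Mu B) [m] y" for y
      using that unfolding rec_eval_simps by auto
    \<comment> \<open>A halting search would give \<open>B\<close> both values 0 and 1 at the index
      found, against determinism.\<close>
    ultimately show "\<not> (\<exists>y. rec_eval (Mu B) [m] y)" by (metis rec_eval_det zero_neq_one)
  qed
qed

section \<open>An interpreter for recursive functions made of tgds\<close>

text \<open>\<open>Main\<close>, the \<open>In\<close> symbols and the \<open>P\<close> symbols hold
  the stored data and stay fixed. The stored chain is therefore copied from \<open>InZero\<close>
  and \<open>InSuc\<close> into \<open>NZero\<close> and \<open>NSuc\<close>, where the computation
  can add numbers of its own.\<close>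

datatype sym =
    Bot | Main | InZero | InSuc | Input
  | PZero | PSucc | PProj0 | PProjS | PComp | PNil | PCons | PRec | PMu
  | NZero | NSuc | LNil | LCons | Same | Less | Eval | Evals | Search

fun arity :: "sym \<Rightarrow> nat" where
  "arity Bot = 0"
| "arity Main = 1" | "arity InZero = 1" | "arity InSuc = 2" | "arity Input = 1"
| "arity PZero = 1" | "arity PSucc = 1" | "arity PProj0 = 1" | "arity PProjS = 2"
| "arity PComp = 3" | "arity PNil = 1" | "arity PCons = 3" | "arity PRec = 3" | "arity PMu = 2"
| "arity NZero = 1" | "arity NSuc = 2" | "arity LNil = 1" | "arity LCons = 3"
| "arity Same = 2" | "arity Less = 2" | "arity Eval = 4" | "arity Evals = 4" | "arity Search = 6"

text \<open>These become the scope of the first procedure; all other relations, \<open>Bot\<close>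
  included, must be the same before and after.\<close>

definition derived_syms :: "sym set" where
  "derived_syms = {NZero, NSuc, LNil, LCons, Same, Less, Eval, Evals, Search}"

text \<open>One type serves for facts and for atoms: the numbers in a fact are domain values, those
  in a rule are variables.\<close>

type_synonym fact = "sym \<times> nat list"
type_synonym rule = "fact list \<times> fact list"

text \<open>Equal images of the body argument lists mean agreement on the body variables; variables
  that occur only in the head are thus existential.\<close>

fun sat :: "fact set \<Rightarrow> rule \<Rightarrow> bool" where
  "sat F (\<phi>, \<psi>) \<longleftrightarrow> (\<forall>\<sigma>. (\<forall>(r, xs) \<in> set \<phi>. (r, map \<sigma> xs) \<in> F) \<longrightarrow>
     (\<exists>\<sigma>'. (\<forall>(r, xs) \<in> set \<phi>. map \<sigma>' xs = map \<sigma> xs) \<and> (\<forall>(r, xs) \<in> set \<psi>. (r, map \<sigma>' xs) \<in> F)))"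

text \<open>\<open>Eval [d, p, l, y]\<close> requests that program \<open>p\<close> maps the argument list \<open>l\<close> to \<open>y\<close>,
  \<open>Evals\<close> is the version for lists of programs, and \<open>Search [d, f, i, l, v, y]\<close> requests
  that \<open>f\<close> maps \<open>i # l\<close> to \<open>v\<close> and that minimisation of \<open>f\<close> from \<open>i\<close> on yields \<open>y\<close>.
  Every request spawns only requests whose first component is smaller with respect to
  \<open>Less\<close>, which is forced to be transitive and, \<open>Bot\<close> being empty, irreflexive, hence
  is well-founded in every finite model. \<open>NSuc [x, y]\<close> says that \<open>y\<close> is the successor of \<open>x\<close>, and
  \<open>LCons [x, l, l']\<close> that \<open>l'\<close> is the list with head \<open>x\<close> and tail \<open>l\<close>.\<close>

definition rules :: "rule list" where
  "rules =
   [([(InZero, [0])], [(NZero, [0])]),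
    ([(InSuc, [0, 1])], [(NSuc, [0, 1])]),
    ([(Main, [0]), (Input, [1])], [(LNil, [2]), (LCons, [1, 2, 3]), (Eval, [4, 0, 3, 5])]),
    ([(Less, [0, 1]), (Less, [1, 2])], [(Less, [0, 2])]),
    ([(Less, [0, 0])], [(Bot, [])]),
    ([(Same, [0, 1]), (NZero, [0])], [(NZero, [1])]),
    ([(Same, [0, 1]), (NSuc, [2, 0])], [(NSuc, [3, 1]), (Same, [2, 3])]),
    ([(Eval, [0, 1, 2, 3]), (PZero, [1])], [(NZero, [3])]),
    ([(Eval, [0, 1, 2, 3]), (PSucc, [1]), (LNil, [2])], [(Bot, [])]),
    ([(Eval, [0, 1, 2, 3]), (PSucc, [1]), (LCons, [4, 5, 2]), (LCons, [6, 7, 5])], [(Bot, [])]),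
    ([(Eval, [0, 1, 2, 3]), (PSucc, [1]), (LCons, [4, 5, 2]), (LNil, [5])], [(NSuc, [4, 3])]),
    ([(Eval, [0, 1, 2, 3]), (PProj0, [1]), (LNil, [2])], [(Bot, [])]),
    ([(Eval, [0, 1, 2, 3]), (PProj0, [1]), (LCons, [4, 5, 2])], [(Same, [4, 3])]),
    ([(Eval, [0, 1, 2, 3]), (PProjS, [1, 4]), (LNil, [2])], [(Bot, [])]),
    ([(Eval, [0, 1, 2, 3]), (PProjS, [1, 4]), (LCons, [5, 6, 2])],
     [(Less, [7, 0]), (Eval, [7, 4, 6, 3])]),
    ([(Eval, [0, 1, 2, 3]), (PComp, [1, 4, 5])],
     [(Less, [6, 0]), (Evals, [6, 5, 2, 8]), (Less, [7, 0]), (Eval, [7, 4, 8, 3])]),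
    ([(Evals, [0, 1, 2, 3]), (PNil, [1])], [(LNil, [3])]),
    ([(Evals, [0, 1, 2, 3]), (PCons, [1, 4, 5])],
     [(Less, [6, 0]), (Eval, [6, 4, 2, 8]), (Less, [7, 0]), (Evals, [7, 5, 2, 9]),
      (LCons, [8, 9, 3])]),
    ([(Eval, [0, 1, 2, 3]), (PRec, [1, 4, 5]), (LNil, [2])], [(Bot, [])]),
    ([(Eval, [0, 1, 2, 3]), (PRec, [1, 4, 5]), (LCons, [6, 7, 2]), (NZero, [6])],
     [(Less, [8, 0]), (Eval, [8, 4, 7, 3])]),
    ([(Eval, [0, 1, 2, 3]), (PRec, [1, 4, 5]), (LCons, [6, 7, 2]), (NSuc, [8, 6])],
     [(LCons, [8, 7, 11]), (Less, [9, 0]), (Eval, [9, 1, 11, 14]), (LCons, [14, 7, 12]),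
      (LCons, [8, 12, 13]), (Less, [10, 0]), (Eval, [10, 5, 13, 3])]),
    ([(Eval, [0, 1, 2, 3]), (PMu, [1, 4])],
     [(NZero, [6]), (Less, [5, 0]), (Search, [5, 4, 6, 2, 7, 3])]),
    ([(Search, [0, 1, 2, 3, 4, 5])], [(LCons, [2, 3, 7]), (Less, [6, 0]), (Eval, [6, 1, 7, 4])]),
    ([(Search, [0, 1, 2, 3, 4, 5]), (NZero, [4])], [(Same, [2, 5])]),
    ([(Search, [0, 1, 2, 3, 4, 5]), (NSuc, [6, 4])],
     [(NSuc, [2, 8]), (Less, [7, 0]), (Search, [7, 1, 8, 3, 9, 5])])]"

instance recf :: countable by countable_datatype

text \<open>A node of the syntax tree is the \<open>to_nat\<close> code of its subprogram. As the
  set of symbols is finite, the index of a projection is unfolded into a chain that descends to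
  \<open>Proj 0\<close>.\<close>

fun prog_facts :: "recf \<Rightarrow> fact set" and progs_facts :: "recf list \<Rightarrow> fact set" where
  "prog_facts Zero = {(PZero, [to_nat Zero])}"
| "prog_facts Succ = {(PSucc, [to_nat Succ])}"
| "prog_facts (Proj i) = insert (PProj0, [to_nat (Proj 0)])
     ((\<lambda>j. (PProjS, [to_nat (Proj (Suc j)), to_nat (Proj j)])) ` {..<i})"
| "prog_facts (Comp f gs) =
     insert (PComp, [to_nat (Comp f gs), to_nat f, to_nat gs]) (prog_facts f \<union> progs_facts gs)"
| "prog_facts (PrimRec f g) =
     insert (PRec, [to_nat (PrimRec f g), to_nat f, to_nat g]) (prog_facts f \<union> prog_facts g)"
| "prog_facts (Mu f) = insert (PMu, [to_nat (Mu f), to_nat f]) (prog_facts f)"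
| "progs_facts [] = {(PNil, [to_nat ([] :: recf list)])}"
| "progs_facts (g # gs) =
     insert (PCons, [to_nat (g # gs), to_nat g, to_nat gs]) (prog_facts g \<union> progs_facts gs)"

text \<open>The split separates the facts that depend on the argument from those that depend on the
  program; the code of the latter will itself become the argument.\<close>

definition input_facts :: "nat \<Rightarrow> fact set" where
  "input_facts m = insert (Input, [m]) ((\<lambda>i. (InSuc, [i, Suc i])) ` {..<m})"

definition static_facts :: "recf \<Rightarrow> fact set" where
  "static_facts p = insert (Main, [to_nat p]) (insert (InZero, [0]) (prog_facts p))"


subsection \<open>Finite models certify halting\<close>

text \<open>An element of a model may represent several numbers: nothing forces \<open>NSuc\<close> to be
  functional or injective.\<close>

primrec represents :: "fact set \<Rightarrow> nat \<Rightarrow> nat \<Rightarrow> bool" where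
  "represents F 0 x \<longleftrightarrow> (NZero, [x]) \<in> F"
| "represents F (Suc n) x \<longleftrightarrow> (\<exists>x'. (NSuc, [x', x]) \<in> F \<and> represents F n x')"

primrec represents_list :: "fact set \<Rightarrow> nat list \<Rightarrow> nat \<Rightarrow> bool" where
  "represents_list F [] l \<longleftrightarrow> (LNil, [l]) \<in> F"
| "represents_list F (n # ns) l \<longleftrightarrow>
     (\<exists>x l'. (LCons, [x, l', l]) \<in> F \<and> represents F n x \<and> represents_list F ns l')"

section \<open>Consequences of the single rules in a finite model\<close>

locale finite_model =
  fixes F :: "fact set"
  assumes finite_F: "finite F"
    and sat_rules: "\<rho> \<in> set rules \<Longrightarrow> sat F \<rho>"
    and no_Bot: "(Bot, []) \<notin> F"
begin

text \<open>Applies the rule with index \<open>i\<close>, giving variable \<open>k\<close> the value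
  \<open>vs ! k\<close>; the lemmas below are its instances for the successive rules.\<close>

lemma fire:
  assumes "i < length rules" "\<forall>(r, xs) \<in> set (fst (rules ! i)). (r, map ((!) vs) xs) \<in> F"
  shows "\<exists>\<sigma>. (\<forall>(r, xs) \<in> set (fst (rules ! i)). map \<sigma> xs = map ((!) vs) xs)
    \<and> (\<forall>(r, xs) \<in> set (snd (rules ! i)). (r, map \<sigma> xs) \<in> F)"
  using sat_rules[OF nth_mem[OF assms(1)]] assms(2)
  by (cases "rules ! i") simp

lemma Zero_of_InZero: "(InZero, [x]) \<in> F \<Longrightarrow> (NZero, [x]) \<in> F"
  using fire[of 0 "[x]"] by (auto simp: rules_def)

lemma Suc_of_InSuc: "(InSuc, [x, y]) \<in> F \<Longrightarrow> (NSuc, [x, y]) \<in> F"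
  using fire[of 1 "[x, y]"] by (auto simp: rules_def)

lemma Eval_of_Main:
  "(Main, [p]) \<in> F \<Longrightarrow> (Input, [x]) \<in> F \<Longrightarrow>
    \<exists>n l d y. (LNil, [n]) \<in> F \<and> (LCons, [x, n, l]) \<in> F \<and> (Eval, [d, p, l, y]) \<in> F"
  using fire[of 2 "[p, x]"] by (fastforce simp: rules_def)

lemma Less_trans: "(Less, [x, y]) \<in> F \<Longrightarrow> (Less, [y, z]) \<in> F \<Longrightarrow> (Less, [x, z]) \<in> F"
  using fire[of 3 "[x, y, z]"] by (auto simp: rules_def)

lemma Less_irrefl: "(Less, [x, x]) \<notin> F"
  using fire[of 4 "[x]"] no_Bot by (auto simp: rules_def)

lemma Same_Zero: "(Same, [x, y]) \<in> F \<Longrightarrow> (NZero, [x]) \<in> F \<Longrightarrow> (NZero, [y]) \<in> F"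
  using fire[of 5 "[x, y]"] by (auto simp: rules_def)

lemma Same_Suc:
  "(Same, [x, y]) \<in> F \<Longrightarrow> (NSuc, [x', x]) \<in> F \<Longrightarrow> \<exists>y'. (NSuc, [y', y]) \<in> F \<and> (Same, [x', y']) \<in> F"
  using fire[of 6 "[x, y, x']"] by (auto simp: rules_def)

lemma Eval_Zero: "(Eval, [d, p, l, y]) \<in> F \<Longrightarrow> (PZero, [p]) \<in> F \<Longrightarrow> (NZero, [y]) \<in> F"
  using fire[of 7 "[d, p, l, y]"] by (auto simp: rules_def)

lemma Eval_Succ_Nil: "(Eval, [d, p, l, y]) \<in> F \<Longrightarrow> (PSucc, [p]) \<in> F \<Longrightarrow> (LNil, [l]) \<notin> F"
  using fire[of 8 "[d, p, l, y]"] no_Bot by (auto simp: rules_def)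

lemma Eval_Succ_Cons:
  "(Eval, [d, p, l, y]) \<in> F \<Longrightarrow> (PSucc, [p]) \<in> F \<Longrightarrow> (LCons, [x, l', l]) \<in> F \<Longrightarrow>
    (LCons, [x', l'', l']) \<notin> F"
  using fire[of 9 "[d, p, l, y, x, l', x', l'']"] no_Bot by (auto simp: rules_def)

lemma Eval_Succ:
  "(Eval, [d, p, l, y]) \<in> F \<Longrightarrow> (PSucc, [p]) \<in> F \<Longrightarrow> (LCons, [x, l', l]) \<in> F \<Longrightarrow>
    (LNil, [l']) \<in> F \<Longrightarrow> (NSuc, [x, y]) \<in> F"
  using fire[of 10 "[d, p, l, y, x, l']"] by (auto simp: rules_def)

lemma Eval_Proj_0_Nil: "(Eval, [d, p, l, y]) \<in> F \<Longrightarrow> (PProj0, [p]) \<in> F \<Longrightarrow> (LNil, [l]) \<notin> F"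
  using fire[of 11 "[d, p, l, y]"] no_Bot by (auto simp: rules_def)

lemma Eval_Proj_0:
  "(Eval, [d, p, l, y]) \<in> F \<Longrightarrow> (PProj0, [p]) \<in> F \<Longrightarrow> (LCons, [x, l', l]) \<in> F \<Longrightarrow>
    (Same, [x, y]) \<in> F"
  using fire[of 12 "[d, p, l, y, x, l']"] by (auto simp: rules_def)

lemma Eval_Proj_Suc_Nil:
  "(Eval, [d, p, l, y]) \<in> F \<Longrightarrow> (PProjS, [p, q]) \<in> F \<Longrightarrow> (LNil, [l]) \<notin> F"
  using fire[of 13 "[d, p, l, y, q]"] no_Bot by (auto simp: rules_def)

lemma Eval_Proj_Suc:
  "(Eval, [d, p, l, y]) \<in> F \<Longrightarrow> (PProjS, [p, q]) \<in> F \<Longrightarrow> (LCons, [x, l', l]) \<in> F \<Longrightarrow>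
    \<exists>d'. (Less, [d', d]) \<in> F \<and> (Eval, [d', q, l', y]) \<in> F"
  using fire[of 14 "[d, p, l, y, q, x, l']"] by (auto simp: rules_def)

lemma Eval_Comp:
  "(Eval, [d, p, l, y]) \<in> F \<Longrightarrow> (PComp, [p, f, gs]) \<in> F \<Longrightarrow>
    \<exists>d' d'' l'. (Less, [d', d]) \<in> F \<and> (Evals, [d', gs, l, l']) \<in> F
      \<and> (Less, [d'', d]) \<in> F \<and> (Eval, [d'', f, l', y]) \<in> F"
  using fire[of 15 "[d, p, l, y, f, gs]"] by (fastforce simp: rules_def)

lemma Evals_Nil: "(Evals, [d, ps, l, l']) \<in> F \<Longrightarrow> (PNil, [ps]) \<in> F \<Longrightarrow> (LNil, [l']) \<in> F"
  using fire[of 16 "[d, ps, l, l']"] by (auto simp: rules_def)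

lemma Evals_Cons:
  "(Evals, [d, ps, l, l']) \<in> F \<Longrightarrow> (PCons, [ps, g, gs]) \<in> F \<Longrightarrow>
    \<exists>d' d'' y l''. (Less, [d', d]) \<in> F \<and> (Eval, [d', g, l, y]) \<in> F
      \<and> (Less, [d'', d]) \<in> F \<and> (Evals, [d'', gs, l, l'']) \<in> F \<and> (LCons, [y, l'', l']) \<in> F"
  using fire[of 17 "[d, ps, l, l', g, gs]"] by (fastforce simp: rules_def)

lemma Eval_PrimRec_Nil:
  "(Eval, [d, p, l, y]) \<in> F \<Longrightarrow> (PRec, [p, f, g]) \<in> F \<Longrightarrow> (LNil, [l]) \<notin> F"
  using fire[of 18 "[d, p, l, y, f, g]"] no_Bot by (auto simp: rules_def)

lemma Eval_PrimRec_0: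
  "(Eval, [d, p, l, y]) \<in> F \<Longrightarrow> (PRec, [p, f, g]) \<in> F \<Longrightarrow> (LCons, [k, l', l]) \<in> F \<Longrightarrow>
    (NZero, [k]) \<in> F \<Longrightarrow> \<exists>d'. (Less, [d', d]) \<in> F \<and> (Eval, [d', f, l', y]) \<in> F"
  using fire[of 19 "[d, p, l, y, f, g, k, l']"] by (auto simp: rules_def)

lemma Eval_PrimRec_Suc:
  "(Eval, [d, p, l, y]) \<in> F \<Longrightarrow> (PRec, [p, f, g]) \<in> F \<Longrightarrow> (LCons, [k, l', l]) \<in> F \<Longrightarrow>
    (NSuc, [k', k]) \<in> F \<Longrightarrow> \<exists>d' d'' l1 l2 l3 r. (LCons, [k', l', l1]) \<in> F \<and> (Less, [d', d]) \<in> F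
      \<and> (Eval, [d', p, l1, r]) \<in> F \<and> (LCons, [r, l', l2]) \<in> F \<and> (LCons, [k', l2, l3]) \<in> F
      \<and> (Less, [d'', d]) \<in> F \<and> (Eval, [d'', g, l3, y]) \<in> F"
  using fire[of 20 "[d, p, l, y, f, g, k, l', k']"]
  by (simp add: rules_def) blast

lemma Eval_Mu:
  "(Eval, [d, p, l, y]) \<in> F \<Longrightarrow> (PMu, [p, f]) \<in> F \<Longrightarrow>
    \<exists>d' z v. (NZero, [z]) \<in> F \<and> (Less, [d', d]) \<in> F \<and> (Search, [d', f, z, l, v, y]) \<in> F"
  using fire[of 21 "[d, p, l, y, f]"] by (fastforce simp: rules_def)

lemma Search_Eval:
  "(Search, [d, f, i, l, v, y]) \<in> F \<Longrightarrow>
    \<exists>d' l'. (LCons, [i, l, l']) \<in> F \<and> (Less, [d', d]) \<in> F \<and> (Eval, [d', f, l', v]) \<in> F"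
  using fire[of 22 "[d, f, i, l, v, y]"] by (fastforce simp: rules_def)

lemma Search_Zero: "(Search, [d, f, i, l, v, y]) \<in> F \<Longrightarrow> (NZero, [v]) \<in> F \<Longrightarrow> (Same, [i, y]) \<in> F"
  using fire[of 23 "[d, f, i, l, v, y]"] by (auto simp: rules_def)

lemma Search_Suc:
  "(Search, [d, f, i, l, v, y]) \<in> F \<Longrightarrow> (NSuc, [w, v]) \<in> F \<Longrightarrow>
    \<exists>d' i' v'. (NSuc, [i, i']) \<in> F \<and> (Less, [d', d]) \<in> F \<and> (Search, [d', f, i', l, v', y]) \<in> F"
  using fire[of 24 "[d, f, i, l, v, y, w]"] by (fastforce simp: rules_def)

section \<open>Soundness by induction along \<open>Less\<close>\<close>

lemma wf_Less: "wf {(x, y). (Less, [x, y]) \<in> F}"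
\<comment> \<open>For a transitive relation, acyclicity is irreflexivity; finiteness of the model
  then gives well-foundedness.\<close>
proof (rule finite_acyclic_wf)
  have "{(x, y). (Less, [x, y]) \<in> F} \<subseteq> (\<lambda>a. (snd a ! 0, snd a ! 1)) ` F"
  proof
    fix a assume "a \<in> {(x, y). (Less, [x, y]) \<in> F}"
    then obtain x y where "a = (x, y)" "(Less, [x, y]) \<in> F" by blast
    then show "a \<in> (\<lambda>a. (snd a ! 0, snd a ! 1)) ` F"
      by (intro image_eqI[of _ _ "(Less, [x, y])"]) simp_all
  qed
  then show "finite {(x, y). (Less, [x, y]) \<in> F}"
    using finite_F by (meson finite_imageI finite_subset)
  have "trans {(x, y). (Less, [x, y]) \<in> F}"
    by (rule transI) (simp, blast intro: Less_trans)
  then show "acyclic {(x, y). (Less, [x, y]) \<in> F}"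
    using Less_irrefl by (simp add: acyclic_def)
qed

text \<open>Tgds cannot force two elements to be equal. \<open>Same\<close> replaces equality by
  descending simultaneously along predecessors, which carries every represented number over.\<close>

lemma represents_Same: "(Same, [x, y]) \<in> F \<Longrightarrow> represents F n x \<Longrightarrow> represents F n y"
proof (induction n arbitrary: x y)
  case 0 then show ?case using Same_Zero by simp
next
  case (Suc n)
  then show ?case using Same_Suc[OF Suc.prems(1)] by (metis represents.simps(2))
qed

lemma represents_input: "static_facts p \<union> input_facts m \<subseteq> F \<Longrightarrow> i \<le> m \<Longrightarrow> represents F i i"
proof (induction i)
  case 0 then show ?case using Zero_of_InZero by (simp add: static_facts_def)
next
  case (Suc i)
  then have "(InSuc, [i, Suc i]) \<in> F" by (auto simp: input_facts_def)
  with Suc show ?case using Suc_of_InSuc by auto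
qed

text \<open>As elements may represent several numbers, every list represented by \<open>l\<close>
  has to be treated, while the result is only required to be one of the numbers represented by
  \<open>y\<close>.\<close>

definition sound_Eval :: "nat \<Rightarrow> bool" where
  "sound_Eval d \<longleftrightarrow> (\<forall>p l y ns. prog_facts p \<subseteq> F \<longrightarrow> (Eval, [d, to_nat p, l, y]) \<in> F \<longrightarrow>
     represents_list F ns l \<longrightarrow> (\<exists>n. represents F n y \<and> rec_eval p ns n))"

definition sound_Evals :: "nat \<Rightarrow> bool" where
  "sound_Evals d \<longleftrightarrow> (\<forall>gs l l' ns. progs_facts gs \<subseteq> F \<longrightarrow> (Evals, [d, to_nat gs, l, l']) \<in> F \<longrightarrow>
     represents_list F ns l \<longrightarrow>
     (\<exists>ms. represents_list F ms l' \<and> list_all2 (\<lambda>g. rec_eval g ns) gs ms))"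

text \<open>Minimisation started at \<open>n\<close>; for \<open>n = 0\<close> the conclusion
  provides the premises of the evaluation rule for \<open>Mu\<close>.\<close>

definition sound_Search :: "nat \<Rightarrow> bool" where
  "sound_Search d \<longleftrightarrow> (\<forall>f i l v y ns n. prog_facts f \<subseteq> F \<longrightarrow>
     (Search, [d, to_nat f, i, l, v, y]) \<in> F \<longrightarrow> represents_list F ns l \<longrightarrow> represents F n i \<longrightarrow>
     (\<exists>k \<ge> n. represents F k y \<and> rec_eval f (k # ns) 0 \<and>
        (\<forall>j. n \<le> j \<and> j < k \<longrightarrow> (\<exists>z. rec_eval f (j # ns) (Suc z)))))"

lemma sound_Eval_step:
  assumes IH: "\<And>d'. (Less, [d', d]) \<in> F \<Longrightarrow> sound_Eval d' \<and> sound_Evals d' \<and> sound_Search d'"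
  shows "sound_Eval d"
  unfolding sound_Eval_def
proof (intro allI impI)
  fix p l y ns
  assume pf: "prog_facts p \<subseteq> F" and ev: "(Eval, [d, to_nat p, l, y]) \<in> F"
    and ns: "represents_list F ns l"
  have IHe: "\<exists>n. represents F n y \<and> rec_eval p ns n"
    if "(Less, [d', d]) \<in> F" "prog_facts p \<subseteq> F" "(Eval, [d', to_nat p, l, y]) \<in> F"
      "represents_list F ns l" for d' p l y ns
    using IH[OF that(1)] that(2-) unfolding sound_Eval_def by blast
  show "\<exists>n. represents F n y \<and> rec_eval p ns n"
  proof (cases p)
    case Zero
    then show ?thesis using Eval_Zero[OF ev] pf by (intro exI[of _ 0]) (simp add: rec_eval.zero)
  next
    case Succ
    then have s: "(PSucc, [to_nat p]) \<in> F" using pf by simp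
    \<comment> \<open>\<open>Succ\<close> has no value on the empty list. A denial rule excludes
      this stuck call, which would otherwise be a request without demands.\<close>
    obtain n ns' where n: "ns = n # ns'"
      using Eval_Succ_Nil[OF ev s] ns by (cases ns) auto
    then obtain x l' where x: "(LCons, [x, l', l]) \<in> F" "represents F n x" "represents_list F ns' l'"
      using ns by auto
    \<comment> \<open>A second denial rule excludes more than one argument.\<close>
    then have "ns' = []" using Eval_Succ_Cons[OF ev s x(1)] by (cases ns') auto
    with x Eval_Succ[OF ev s x(1)] n Succ show ?thesis
      by (intro exI[of _ "Suc n"]) (auto intro: rec_eval.succ)
  next
    case (Proj i)
    show ?thesis
    proof (cases i)
      case 0
      then have s: "(PProj0, [to_nat p]) \<in> F" using pf Proj by simp
      obtain n ns' where n: "ns = n # ns'"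
        using Eval_Proj_0_Nil[OF ev s] ns by (cases ns) auto
      then obtain x l' where x: "(LCons, [x, l', l]) \<in> F" "represents F n x"
        using ns by auto
      have "represents F n y" using represents_Same[OF Eval_Proj_0[OF ev s x(1)] x(2)] .
      moreover have "rec_eval p ns n" using rec_eval.proj[of 0 ns] n Proj 0 by simp
      ultimately show ?thesis by blast
    next
      case (Suc j)
      then have s: "(PProjS, [to_nat p, to_nat (Proj j)]) \<in> F" "prog_facts (Proj j) \<subseteq> F"
        using pf Proj by auto
      obtain n ns' where n: "ns = n # ns'"
        using Eval_Proj_Suc_Nil[OF ev s(1)] ns by (cases ns) auto
      then obtain x l' where x: "(LCons, [x, l', l]) \<in> F" "represents_list F ns' l'"
        using ns by auto
      from Eval_Proj_Suc[OF ev s(1) x(1)] obtain d' where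
        "(Less, [d', d]) \<in> F" "(Eval, [d', to_nat (Proj j), l', y]) \<in> F" by blast
      from IHe[OF this(1) s(2) this(2) x(2)] obtain k
        where k: "represents F k y" "rec_eval (Proj j) ns' k" by blast
      \<comment> \<open>The request concerned the tail, so the index shifts by one on the way
        back.\<close>
      from k(2) have "j < length ns'" "k = ns' ! j" by (auto elim: rec_eval.cases)
      then have "rec_eval p ns k" using rec_eval.proj[of "Suc j" ns] n Proj Suc by simp
      with k(1) show ?thesis by blast
    qed
  next
    case (Comp f gs)
    then have s: "(PComp, [to_nat p, to_nat f, to_nat gs]) \<in> F"
        "prog_facts f \<subseteq> F" "progs_facts gs \<subseteq> F"
      using pf by auto
    from Eval_Comp[OF ev s(1)] obtain d' d'' l' where
      d': "(Less, [d', d]) \<in> F" "(Evals, [d', to_nat gs, l, l']) \<in> F"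
      and d'': "(Less, [d'', d]) \<in> F" "(Eval, [d'', to_nat f, l', y]) \<in> F" by blast
    from IH[OF d'(1)] s(3) d'(2) ns obtain ms
      where ms: "represents_list F ms l'" "list_all2 (\<lambda>g. rec_eval g ns) gs ms"
      unfolding sound_Evals_def by blast
    from IHe[OF d''(1) s(2) d''(2) ms(1)] obtain n
      where "represents F n y" "rec_eval f ms n" by blast
    with ms(2) Comp show ?thesis by (auto intro: rec_eval.comp)
  next
    case (PrimRec f g)
    then have s: "(PRec, [to_nat p, to_nat f, to_nat g]) \<in> F"
        "prog_facts f \<subseteq> F" "prog_facts g \<subseteq> F"
      using pf by auto
    obtain n ns' where n: "ns = n # ns'"
      using Eval_PrimRec_Nil[OF ev s(1)] ns by (cases ns) auto
    then obtain x l' where x: "(LCons, [x, l', l]) \<in> F" "represents F n x" "represents_list F ns' l'"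
      using ns by auto
    show ?thesis
    proof (cases n)
      case 0
      then have "(NZero, [x]) \<in> F" using x(2) by simp
      from Eval_PrimRec_0[OF ev s(1) x(1) this] obtain d' where
        "(Less, [d', d]) \<in> F" "(Eval, [d', to_nat f, l', y]) \<in> F" by blast
      from IHe[OF this(1) s(2) this(2) x(3)] obtain k
        where "represents F k y" "rec_eval f ns' k" by blast
      then show ?thesis using n 0 PrimRec by (auto intro: rec_eval.prim_0)
    next
      case (Suc m)
      then obtain x' where x': "(NSuc, [x', x]) \<in> F" "represents F m x'" using x(2) by auto
      from Eval_PrimRec_Suc[OF ev s(1) x(1) x'(1)] obtain d' d'' l1 l2 l3 r where
        l: "(LCons, [x', l', l1]) \<in> F" "(LCons, [r, l', l2]) \<in> F" "(LCons, [x', l2, l3]) \<in> F"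
        and d': "(Less, [d', d]) \<in> F" "(Eval, [d', to_nat p, l1, r]) \<in> F"
        and d'': "(Less, [d'', d]) \<in> F" "(Eval, [d'', to_nat g, l3, y]) \<in> F" by blast
      \<comment> \<open>\<open>l1\<close> is the argument list of the recursive call. With
        \<open>k\<close> the value represented by \<open>r\<close>, \<open>l2\<close> stands for
        \<open>k # ns'\<close> and \<open>l3\<close> for the arguments of \<open>g\<close>.\<close>
      have "represents_list F (m # ns') l1" using l(1) x' x(3) by auto
      from IHe[OF d'(1) pf d'(2) this] obtain k
        where k: "represents F k r" "rec_eval p (m # ns') k" by blast
      have "represents_list F (m # k # ns') l3" using l(2,3) x' x(3) k(1) by auto
      from IHe[OF d''(1) s(3) d''(2) this] obtain z
        where "represents F z y" "rec_eval g (m # k # ns') z" by blast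
      then show ?thesis using k(2) n Suc PrimRec by (auto intro: rec_eval.prim_Suc)
    qed
  next
    case (Mu f)
    then have s: "(PMu, [to_nat p, to_nat f]) \<in> F" "prog_facts f \<subseteq> F" using pf by auto
    from Eval_Mu[OF ev s(1)] obtain d' z v where
      d': "(NZero, [z]) \<in> F" "(Less, [d', d]) \<in> F" "(Search, [d', to_nat f, z, l, v, y]) \<in> F"
      by blast
    \<comment> \<open>The search starts at 0, so its lower bound on the tested indices becomes
      vacuous.\<close>
    have "represents F 0 z" using d'(1) by simp
    with IH[OF d'(2)] s(2) d'(3) ns obtain k
      where "represents F k y" "rec_eval f (k # ns) 0"
        "\<forall>j. 0 \<le> j \<and> j < k \<longrightarrow> (\<exists>z. rec_eval f (j # ns) (Suc z))"
      unfolding sound_Search_def by blast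
    then have "rec_eval p ns k" unfolding Mu by (intro rec_eval.mu) simp_all
    with \<open>represents F k y\<close> show ?thesis by blast
  qed
qed

lemma sound_Evals_step:
  assumes IH: "\<And>d'. (Less, [d', d]) \<in> F \<Longrightarrow> sound_Eval d' \<and> sound_Evals d'"
  shows "sound_Evals d"
  unfolding sound_Evals_def
proof (intro allI impI)
  fix gs l l' ns
  assume pf: "progs_facts gs \<subseteq> F" and ev: "(Evals, [d, to_nat gs, l, l']) \<in> F"
    and ns: "represents_list F ns l"
  show "\<exists>ms. represents_list F ms l' \<and> list_all2 (\<lambda>g. rec_eval g ns) gs ms"
  proof (cases gs)
    case Nil
    then show ?thesis using Evals_Nil[OF ev] pf by (intro exI[of _ "[]"]) auto
  next
    case (Cons g gs')
    then have s: "(PCons, [to_nat gs, to_nat g, to_nat gs']) \<in> F"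
        "prog_facts g \<subseteq> F" "progs_facts gs' \<subseteq> F"
      using pf by auto
    from Evals_Cons[OF ev s(1)] obtain d' d'' y l'' where
      d': "(Less, [d', d]) \<in> F" "(Eval, [d', to_nat g, l, y]) \<in> F"
      and d'': "(Less, [d'', d]) \<in> F" "(Evals, [d'', to_nat gs', l, l'']) \<in> F"
      and l': "(LCons, [y, l'', l']) \<in> F" by blast
    from IH[OF d'(1)] s(2) d'(2) ns obtain n where "represents F n y" "rec_eval g ns n"
      unfolding sound_Eval_def by blast
    moreover from IH[OF d''(1)] s(3) d''(2) ns obtain ms
      where "represents_list F ms l''" "list_all2 (\<lambda>g. rec_eval g ns) gs' ms"
      unfolding sound_Evals_def by blast
    ultimately show ?thesis using l' Cons by (intro exI[of _ "n # ms"]) auto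
  qed
qed

lemma sound_Search_step:
  assumes IH: "\<And>d'. (Less, [d', d]) \<in> F \<Longrightarrow> sound_Eval d' \<and> sound_Search d'"
  shows "sound_Search d"
  unfolding sound_Search_def
proof (intro allI impI)
  fix f i l v y ns n
  assume pf: "prog_facts f \<subseteq> F" and ev: "(Search, [d, to_nat f, i, l, v, y]) \<in> F"
    and ns: "represents_list F ns l" and n: "represents F n i"
  from Search_Eval[OF ev] obtain d' l' where
    d': "(LCons, [i, l, l']) \<in> F" "(Less, [d', d]) \<in> F" "(Eval, [d', to_nat f, l', v]) \<in> F"
    by blast
  have "represents_list F (n # ns) l'" using d'(1) n ns by auto
  with IH[OF d'(2)] pf d'(3) obtain z where z: "represents F z v" "rec_eval f (n # ns) z"
    unfolding sound_Eval_def by blast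
  show "\<exists>k \<ge> n. represents F k y \<and> rec_eval f (k # ns) 0 \<and>
    (\<forall>j. n \<le> j \<and> j < k \<longrightarrow> (\<exists>z. rec_eval f (j # ns) (Suc z)))"
  \<comment> \<open>The value of \<open>f\<close> at \<open>n\<close> decides which rule fires: 0
    ends the search at \<open>i\<close>, a successor moves it on to \<open>i'\<close>.\<close>
  proof (cases z)
    case 0
    then have "(Same, [i, y]) \<in> F" using Search_Zero[OF ev] z(1) by simp
    then have "represents F n y" using n represents_Same by blast
    then show ?thesis using z(2) 0 by (intro exI[of _ n]) auto
  next
    case (Suc z')
    then obtain w where "(NSuc, [w, v]) \<in> F" using z(1) by auto
    from Search_Suc[OF ev this] obtain d' i' v' where
      d': "(NSuc, [i, i']) \<in> F" "(Less, [d', d]) \<in> F" "(Search, [d', to_nat f, i', l, v', y]) \<in> F"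
      by blast
    have "represents F (Suc n) i'" using d'(1) n by auto
    with IH[OF d'(2)] pf d'(3) ns obtain k where k: "k \<ge> Suc n" "represents F k y"
        "rec_eval f (k # ns) 0"
        "\<forall>j. Suc n \<le> j \<and> j < k \<longrightarrow> (\<exists>z. rec_eval f (j # ns) (Suc z))"
      unfolding sound_Search_def by blast
    \<comment> \<open>The index \<open>n\<close> was tested in this step, all larger ones in the
      remaining search.\<close>
    have "\<exists>z. rec_eval f (j # ns) (Suc z)" if "n \<le> j" "j < k" for j
      using that k(4) z(2) Suc by (cases "j = n") auto
    then show ?thesis using k by (intro exI[of _ k]) auto
  qed
qed

lemma sound: "sound_Eval d \<and> sound_Evals d \<and> sound_Search d"
proof (induction d rule: wf_induct_rule[OF wf_Less])
  case (1 d)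
  then have "\<And>d'. (Less, [d', d]) \<in> F \<Longrightarrow> sound_Eval d' \<and> sound_Evals d' \<and> sound_Search d'"
    by blast
  then show ?case
    using sound_Eval_step[of d] sound_Evals_step[of d] sound_Search_step[of d] by blast
qed

lemma model_halts:
  assumes "static_facts p \<union> input_facts m \<subseteq> F"
  shows "\<exists>y. rec_eval p [m] y"
proof -
  have "(Main, [to_nat p]) \<in> F" "(Input, [m]) \<in> F" "prog_facts p \<subseteq> F"
    using assms by (auto simp: static_facts_def input_facts_def)
  moreover from Eval_of_Main[OF this(1,2)] obtain n l d y where
    "(LNil, [n]) \<in> F" "(LCons, [m, n, l]) \<in> F" "(Eval, [d, to_nat p, l, y]) \<in> F" by blast
  moreover from this have "represents_list F [m] l"
    using represents_input[OF assms order.refl] by auto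
  ultimately show ?thesis using sound[of d] unfolding sound_Eval_def by blast
qed

end

subsection \<open>Halting computations have finite models\<close>

datatype item =
    Ev nat recf "nat list" nat
  | Evs nat "recf list" "nat list" "nat list"
  | Srch nat recf nat "nat list" nat nat

text \<open>The evaluation rules as local conditions on a pool \<open>T\<close> of requests with
  their true values. The first component of an item is a stamp that decreases towards the premises
  and yields the \<open>Less\<close> facts. In \<open>Srch d f i ns v y\<close>, \<open>v\<close> is
  the value of \<open>f\<close> at \<open>i\<close> and \<open>y\<close> the result of the
  search.\<close>

inductive justified :: "item set \<Rightarrow> item \<Rightarrow> bool" for T where
  Zero: "justified T (Ev d Zero ns 0)"
| Succ: "justified T (Ev d Succ [n] (Suc n))"
| Proj_0: "justified T (Ev d (Proj 0) (n # ns) n)"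
| Proj_Suc: "d' < d \<Longrightarrow> Ev d' (Proj i) ns y \<in> T \<Longrightarrow> justified T (Ev d (Proj (Suc i)) (n # ns) y)"
| Comp: "d' < d \<Longrightarrow> Evs d' gs ns ms \<in> T \<Longrightarrow> d'' < d \<Longrightarrow> Ev d'' f ms y \<in> T \<Longrightarrow>
    justified T (Ev d (Comp f gs) ns y)"
| Nil: "justified T (Evs d [] ns [])"
| Cons: "d' < d \<Longrightarrow> Ev d' g ns y \<in> T \<Longrightarrow> d'' < d \<Longrightarrow> Evs d'' gs ns ms \<in> T \<Longrightarrow>
    justified T (Evs d (g # gs) ns (y # ms))"
| PrimRec_0: "d' < d \<Longrightarrow> Ev d' f ns y \<in> T \<Longrightarrow> justified T (Ev d (PrimRec f g) (0 # ns) y)"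
| PrimRec_Suc: "d' < d \<Longrightarrow> Ev d' (PrimRec f g) (k # ns) r \<in> T \<Longrightarrow> d'' < d \<Longrightarrow>
    Ev d'' g (k # r # ns) y \<in> T \<Longrightarrow> justified T (Ev d (PrimRec f g) (Suc k # ns) y)"
| Mu: "d' < d \<Longrightarrow> Srch d' f 0 ns v y \<in> T \<Longrightarrow> justified T (Ev d (Mu f) ns y)"
| Search_0: "d' < d \<Longrightarrow> Ev d' f (i # ns) 0 \<in> T \<Longrightarrow> justified T (Srch d f i ns 0 i)"
| Search_Suc: "d' < d \<Longrightarrow> Ev d' f (i # ns) (Suc v) \<in> T \<Longrightarrow> d'' < d \<Longrightarrow>
    Srch d'' f (Suc i) ns w y \<in> T \<Longrightarrow> justified T (Srch d f i ns (Suc v) y)"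

inductive_cases justifiedE:
  "justified T (Ev d Zero ns y)" "justified T (Ev d Succ ns y)"
  "justified T (Ev d (Proj 0) ns y)" "justified T (Ev d (Proj (Suc i)) ns y)"
  "justified T (Ev d (Comp f gs) ns y)" "justified T (Ev d (PrimRec f g) ns y)"
  "justified T (Ev d (Mu f) ns y)" "justified T (Evs d [] ns ms)"
  "justified T (Evs d (g # gs) ns ms)" "justified T (Srch d f i ns v y)"

lemma justified_mono: "justified T it \<Longrightarrow> T \<subseteq> T' \<Longrightarrow> justified T' it"
  by (induction rule: justified.induct) (blast intro: justified.intros)+

definition closed :: "item set \<Rightarrow> bool" where
  "closed T \<longleftrightarrow> (\<forall>it \<in> T. justified T it)"

text \<open>The stamp is left open, so that it can be chosen above those of the premises when pools
  are combined.\<close>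

definition derivable :: "(nat \<Rightarrow> item) \<Rightarrow> bool" where
  "derivable c \<longleftrightarrow> (\<exists>T d. finite T \<and> closed T \<and> c d \<in> T)"

text \<open>The union of two closed pools is closed, since justification is monotone in the pool;
  the conclusion joins it with a fresh larger stamp.\<close>

lemma derivable_step2:
  assumes "derivable a" "derivable b"
    and just: "\<And>T d d' d''. d' < d \<Longrightarrow> a d' \<in> T \<Longrightarrow> d'' < d \<Longrightarrow> b d'' \<in> T \<Longrightarrow> justified T (c d)"
  shows "derivable c"
proof -
  obtain T d' U d'' where T: "finite T" "closed T" "a d' \<in> T"
      and U: "finite U" "closed U" "b d'' \<in> U"
    using assms(1,2) unfolding derivable_def by blast
  define d where "d = Suc (max d' d'')"
  have "justified (T \<union> U) (c d)"
    by (rule just[of d' d _ d'']) (use T U in \<open>auto simp: d_def\<close>)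
  then have "closed (insert (c d) (T \<union> U))"
    using T(2) U(2) unfolding closed_def by (blast intro: justified_mono)
  then show ?thesis using T(1) U(1) unfolding derivable_def
    by (intro exI[of _ "insert (c d) (T \<union> U)"] exI[of _ d]) simp
qed

lemma derivable_step1:
  assumes "derivable a" "\<And>T d d'. d' < d \<Longrightarrow> a d' \<in> T \<Longrightarrow> justified T (c d)"
  shows "derivable c"
  \<comment> \<open>The single premise is used in both places.\<close>
  by (rule derivable_step2[OF assms(1,1)]) (rule assms(2))

lemma derivable_step0:
  assumes "\<And>T d. justified T (c d)" shows "derivable c"
  unfolding derivable_def closed_def
  by (intro exI[of _ "{c 0}"] exI[of _ 0]) (simp add: assms)

lemma derivable_Proj: "i < length ns \<Longrightarrow> derivable (\<lambda>d. Ev d (Proj i) ns (ns ! i))"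
proof (induction i arbitrary: ns)
  case 0
  then obtain n ns' where "ns = n # ns'" by (cases ns) auto
  then show ?case by (intro derivable_step0) (simp add: justified.Proj_0)
next
  case (Suc i)
  then obtain n ns' where ns: "ns = n # ns'" by (cases ns) auto
  with Suc have "derivable (\<lambda>d. Ev d (Proj i) ns' (ns' ! i))" by simp
  then show ?case unfolding ns by (rule derivable_step1) (simp add: justified.Proj_Suc)
qed

lemma derivable_Evs:
  "list_all2 (\<lambda>g y. derivable (\<lambda>d. Ev d g ns y)) gs ms \<Longrightarrow> derivable (\<lambda>d. Evs d gs ns ms)"
proof (induction rule: list_all2_induct)
  case Nil show ?case by (rule derivable_step0) (rule justified.Nil)
next
  case (Cons g gs y ms)
  from Cons(1,3) show ?case by (rule derivable_step2) (rule justified.Cons)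
qed

text \<open>Downward induction from the result \<open>n\<close>: the item at \<open>n\<close> is
  justified by the zero found there, each earlier one by its successor and the positive value at its
  own index.\<close>

lemma derivable_Srch:
  assumes "derivable (\<lambda>d. Ev d f (n # ns) 0)"
    and "\<And>i. i < n \<Longrightarrow> \<exists>v. derivable (\<lambda>d. Ev d f (i # ns) (Suc v))"
    and "i \<le> n"
  shows "\<exists>v. derivable (\<lambda>d. Srch d f i ns v n)"
  using assms(3)
proof (induction rule: inc_induct)
  case base
  from assms(1) have "derivable (\<lambda>d. Srch d f n ns 0 n)"
    by (rule derivable_step1) (rule justified.Search_0)
  then show ?case by blast
next
  case (step i)
  from step obtain w where w: "derivable (\<lambda>d. Srch d f (Suc i) ns w n)" by blast
  from step assms(2) obtain v where "derivable (\<lambda>d. Ev d f (i # ns) (Suc v))" by blast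
  from this w have "derivable (\<lambda>d. Srch d f i ns (Suc v) n)"
    by (rule derivable_step2) (rule justified.Search_Suc)
  then show ?case by blast
qed

lemma derivable_rec_eval: "rec_eval p ns y \<Longrightarrow> derivable (\<lambda>d. Ev d p ns y)"
proof (induction rule: rec_eval.induct)
  case (zero xs) show ?case by (rule derivable_step0) (rule justified.Zero)
next
  case (succ x) show ?case by (rule derivable_step0) (rule justified.Succ)
next
  case (proj i xs) then show ?case by (rule derivable_Proj)
next
  case (comp xs gs ys f z)
  have "list_all2 (\<lambda>g y. derivable (\<lambda>d. Ev d g xs y)) gs ys"
    by (rule list_all2_mono[OF comp.IH(1)]) blast
  from derivable_Evs[OF this] comp.IH(2) show ?case
    by (rule derivable_step2) (rule justified.Comp)
next
  case (prim_0 f xs z g)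
  from prim_0.IH show ?case by (rule derivable_step1) (rule justified.PrimRec_0)
next
  case (prim_Suc f g n xs r z)
  from prim_Suc.IH show ?case by (rule derivable_step2) (rule justified.PrimRec_Suc)
next
  case (mu f n xs)
  from derivable_Srch[OF mu.IH(1), of 0] mu.IH(2)
  obtain v where "derivable (\<lambda>d. Srch d f 0 xs v n)" by blast
  then show ?case by (rule derivable_step1) (rule justified.Mu)
qed

section \<open>The model built from a closed pool of items\<close>

fun item_fact :: "item \<Rightarrow> fact" where
  "item_fact (Ev d p ns y) = (Eval, [d, to_nat p, list_encode ns, y])"
| "item_fact (Evs d gs ns ms) = (Evals, [d, to_nat gs, list_encode ns, list_encode ms])"
| "item_fact (Srch d f i ns v y) = (Search, [d, to_nat f, i, list_encode ns, v, y])"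

text \<open>The possible shapes of a syntax fact, independent of the program it comes from; they can
  be inverted without recursion on that program.\<close>

fun prog_fact :: "fact \<Rightarrow> bool" where
  "prog_fact (PZero, vs) \<longleftrightarrow> vs = [to_nat Zero]"
| "prog_fact (PSucc, vs) \<longleftrightarrow> vs = [to_nat Succ]"
| "prog_fact (PProj0, vs) \<longleftrightarrow> vs = [to_nat (Proj 0)]"
| "prog_fact (PProjS, vs) \<longleftrightarrow> (\<exists>i. vs = [to_nat (Proj (Suc i)), to_nat (Proj i)])"
| "prog_fact (PComp, vs) \<longleftrightarrow> (\<exists>f gs. vs = [to_nat (Comp f gs), to_nat f, to_nat gs])"
| "prog_fact (PNil, vs) \<longleftrightarrow> vs = [to_nat ([] :: recf list)]"
| "prog_fact (PCons, vs) \<longleftrightarrow> (\<exists>g gs. vs = [to_nat (g # gs :: recf list), to_nat g, to_nat gs])"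
| "prog_fact (PRec, vs) \<longleftrightarrow> (\<exists>f g. vs = [to_nat (PrimRec f g), to_nat f, to_nat g])"
| "prog_fact (PMu, vs) \<longleftrightarrow> (\<exists>f. vs = [to_nat (Mu f), to_nat f])"
| "prog_fact _ \<longleftrightarrow> False"

lemma prog_fact_prog_facts:
  "a \<in> prog_facts p \<Longrightarrow> prog_fact a" "a \<in> progs_facts ps \<Longrightarrow> prog_fact a"
  by (induction p and ps rule: prog_facts_progs_facts.induct) auto

lemma arity_prog_fact: "prog_fact (r, vs) \<Longrightarrow> length vs = arity r"
  by (cases r) auto

lemma arity_item_fact: "(r, vs) = item_fact it \<Longrightarrow> length vs = arity r"
  by (cases it) auto

lemma finite_prog_facts: "finite (prog_facts p)" "finite (progs_facts ps)"
  by (induction p and ps rule: prog_facts_progs_facts.induct) auto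

lemma to_nat_eq_iff: "to_nat x = to_nat y \<longleftrightarrow> x = y"
  by (simp add: inj_eq)

lemma satI:
  assumes "\<And>\<sigma>. \<forall>(r, xs) \<in> set \<phi>. (r, map \<sigma> xs) \<in> F \<Longrightarrow>
    \<exists>vs. (\<forall>(r, xs) \<in> set \<phi>. map ((!) vs) xs = map \<sigma> xs) \<and> (\<forall>(r, xs) \<in> set \<psi>. (r, map ((!) vs) xs) \<in> F)"
  shows "sat F (\<phi>, \<psi>)"
  using assms by (simp only: sat.simps) blast

lemma sat_datalogI:
  assumes "\<And>\<sigma>. \<forall>(r, xs) \<in> set \<phi>. (r, map \<sigma> xs) \<in> F \<Longrightarrow> \<forall>(r, xs) \<in> set \<psi>. (r, map \<sigma> xs) \<in> F"
  shows "sat F (\<phi>, \<psi>)"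
  using assms by (simp only: sat.simps) blast

text \<open>\<open>B\<close> exceeds every component of every fact in the pool; the infinite
  relations on numbers and lists are cut off there to obtain a finite model.\<close>

locale computation =
  fixes p :: recf and m :: nat and T :: "item set" and B d0 y0 :: nat
  assumes finite_T: "finite T" and closed_T: "closed T"
    and start: "Ev d0 p [m] y0 \<in> T"
    and bound: "it \<in> T \<Longrightarrow> v \<in> set (snd (item_fact it)) \<Longrightarrow> v < B"
begin

definition number_facts :: "fact set" where
  "number_facts = {(NZero, [0]), (LNil, [list_encode []])}
     \<union> (\<lambda>i. (NSuc, [i, Suc i])) ` {i. Suc i < B}
     \<union> (\<lambda>i. (Same, [i, i])) ` {..<B}
     \<union> (\<lambda>(i, j). (Less, [i, j])) ` {(i, j). i < j \<and> j < B}
     \<union> (\<lambda>(n, ns). (LCons, [n, list_encode ns, list_encode (n # ns)]))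
         ` {(n, ns). list_encode (n # ns) < B}"

definition model :: "fact set" where
  "model = static_facts p \<union> input_facts m \<union> item_fact ` T \<union> number_facts"

text \<open>\<open>list_encode\<close> adds one to a pairing, and a pairing is at least both
  components. A bound on the code of a list hence bounds its entries and tails.\<close>

lemma list_encode_Cons: "n < list_encode (n # ns)" "list_encode ns < list_encode (n # ns)"
  by (simp_all add: le_prod_encode_1 le_prod_encode_2 less_Suc_eq_le)

declare list_encode.simps [simp del]

lemma finite_model: "finite model"
proof -
  have "finite {(i, j). i < j \<and> j < B}"
    by (rule finite_subset[of _ "{..<B} \<times> {..<B}"]) auto
  moreover have "finite {(n, ns). list_encode (n # ns) < B}"
  proof (rule finite_subset)
    \<comment> \<open>Head and tail have codes below \<open>B\<close>, and injectivity of
      \<open>list_encode\<close> leaves only finitely many tails.\<close>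
    show "{(n, ns). list_encode (n # ns) < B} \<subseteq> {..<B} \<times> (list_encode -` {..<B})"
      by (auto intro: less_trans[OF list_encode_Cons(1)] less_trans[OF list_encode_Cons(2)])
    show "finite ({..<B} \<times> (list_encode -` {..<B}))"
      by (intro finite_cartesian_product finite_vimageI inj_list_encode) simp_all
  qed
  moreover have "finite {i. Suc i < B}"
    by (rule finite_subset[of _ "{..<B}"]) auto
  ultimately show ?thesis
    using finite_T finite_prog_facts
    by (simp add: model_def number_facts_def static_facts_def input_facts_def)
qed

lemma item_fact_iff:
  "(Eval, vs) = item_fact it \<longleftrightarrow>
    (\<exists>d q ns y. it = Ev d q ns y \<and> vs = [d, to_nat q, list_encode ns, y])"
  "(Evals, vs) = item_fact it \<longleftrightarrow>
    (\<exists>d qs ns ms. it = Evs d qs ns ms \<and> vs = [d, to_nat qs, list_encode ns, list_encode ms])"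
  "(Search, vs) = item_fact it \<longleftrightarrow>
    (\<exists>d f i ns v y. it = Srch d f i ns v y \<and> vs = [d, to_nat f, i, list_encode ns, v, y])"
  by (cases it; auto)+

lemma item_fact_not:
  "r \<notin> {Eval, Evals, Search} \<Longrightarrow> (r, vs) \<noteq> item_fact it"
  by (cases it) auto

lemma not_prog_facts:
  "\<not> prog_fact a \<Longrightarrow> a \<notin> prog_facts q"
  using prog_fact_prog_facts by blast

lemmas mem_model_simps = model_def number_facts_def static_facts_def input_facts_def
  image_iff item_fact_iff item_fact_not not_prog_facts Bex_def

text \<open>Read from left to right, these equivalences reduce the check of a rule to a statement
  about \<open>T\<close>, the bound \<open>B\<close> and codes.\<close>

lemma mem_model:
  "(Bot, vs) \<notin> model"
  "(Main, [x]) \<in> model \<longleftrightarrow> x = to_nat p"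
  "(Input, [x]) \<in> model \<longleftrightarrow> x = m"
  "(InZero, [x]) \<in> model \<longleftrightarrow> x = 0"
  "(InSuc, [x, y]) \<in> model \<longleftrightarrow> y = Suc x \<and> x < m"
  "(NZero, [x]) \<in> model \<longleftrightarrow> x = 0"
  "(NSuc, [x, y]) \<in> model \<longleftrightarrow> y = Suc x \<and> y < B"
  "(Same, [x, y]) \<in> model \<longleftrightarrow> x = y \<and> y < B"
  "(Less, [x, y]) \<in> model \<longleftrightarrow> x < y \<and> y < B"
  "(LNil, [l]) \<in> model \<longleftrightarrow> l = list_encode []"
  "(LCons, [x, l, l']) \<in> model \<longleftrightarrow>
     (\<exists>ns. l = list_encode ns \<and> l' = list_encode (x # ns) \<and> l' < B)"
  "(Eval, [d, c, l, y]) \<in> model \<longleftrightarrow>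
     (\<exists>q ns. c = to_nat q \<and> l = list_encode ns \<and> Ev d q ns y \<in> T)"
  "(Evals, [d, c, l, l']) \<in> model \<longleftrightarrow>
     (\<exists>qs ns ms. c = to_nat qs \<and> l = list_encode ns \<and> l' = list_encode ms \<and> Evs d qs ns ms \<in> T)"
  "(Search, [d, c, i, l, v, y]) \<in> model \<longleftrightarrow>
     (\<exists>f ns. c = to_nat f \<and> l = list_encode ns \<and> Srch d f i ns v y \<in> T)"
  by (auto simp: mem_model_simps)

text \<open>Syntax symbols occur only in bodies of rules, so one direction suffices: a match reveals
  the shape of the program.\<close>

lemma mem_model_prog:
  assumes "(r, vs) \<in> model" "r \<in> {PZero, PSucc, PProj0, PProjS, PComp, PNil, PCons, PRec, PMu}"
  shows "prog_fact (r, vs)"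
proof -
  have "(r, vs) \<in> prog_facts p"
    using assms by (auto simp: model_def number_facts_def static_facts_def input_facts_def
      image_iff item_fact_not)
  then show ?thesis by (rule prog_fact_prog_facts)
qed

lemma just: "it \<in> T \<Longrightarrow> justified T it"
  using closed_T by (simp add: closed_def)

lemma bound_Ev: "Ev d q ns y \<in> T \<Longrightarrow> d < B \<and> list_encode ns < B \<and> y < B"
  using bound[of "Ev d q ns y"] by simp

lemma bound_Evs: "Evs d qs ns ms \<in> T \<Longrightarrow> d < B \<and> list_encode ns < B \<and> list_encode ms < B"
  using bound[of "Evs d qs ns ms"] by simp

lemma bound_Srch:
  "Srch d f i ns v y \<in> T \<Longrightarrow> d < B \<and> i < B \<and> list_encode ns < B \<and> v < B \<and> y < B"
  using bound[of "Srch d f i ns v y"] by simp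

lemma mem_progD:
  "(PZero, [x]) \<in> model \<Longrightarrow> x = to_nat Zero"
  "(PSucc, [x]) \<in> model \<Longrightarrow> x = to_nat Succ"
  "(PProj0, [x]) \<in> model \<Longrightarrow> x = to_nat (Proj 0)"
  "(PProjS, [x, y]) \<in> model \<Longrightarrow> \<exists>i. x = to_nat (Proj (Suc i)) \<and> y = to_nat (Proj i)"
  "(PComp, [x, y, z]) \<in> model \<Longrightarrow> \<exists>f gs. x = to_nat (Comp f gs) \<and> y = to_nat f \<and> z = to_nat gs"
  "(PNil, [x]) \<in> model \<Longrightarrow> x = to_nat ([] :: recf list)"
  "(PCons, [x, y, z]) \<in> model \<Longrightarrow>
     \<exists>g gs. x = to_nat (g # gs :: recf list) \<and> y = to_nat g \<and> z = to_nat gs"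
  "(PRec, [x, y, z]) \<in> model \<Longrightarrow> \<exists>f g. x = to_nat (PrimRec f g) \<and> y = to_nat f \<and> z = to_nat g"
  "(PMu, [x, y]) \<in> model \<Longrightarrow> \<exists>f. x = to_nat (Mu f) \<and> y = to_nat f"
  by (drule mem_model_prog; simp)+

lemmas T_cases = justifiedE[OF just]

lemmas codes = to_nat_eq_iff list_encode_eq

text \<open>A match of a request in a body decodes to an item of \<open>T\<close>. Its justification
  supplies the existential head values, listed in the order of the variable numbers.\<close>

lemma sat_model: "list_all (sat model) rules"
  unfolding rules_def list.pred_inject simp_thms
proof (intro conjI, goal_cases)
  case 1 show ?case by (rule sat_datalogI) (simp add: mem_model)
next
  \<comment> \<open>A stored successor is at most \<open>m\<close>, and \<open>m\<close> is below
    the code of \<open>[m]\<close>, hence below \<open>B\<close>.\<close>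
  case 2 show ?case using bound_Ev[OF start] list_encode_Cons(1)[of m "[]"]
    by (intro sat_datalogI) (simp add: mem_model)
next
  case 3
  show ?case
  proof (rule satI, goal_cases)
    case (1 \<sigma>)
    then have "\<sigma> 0 = to_nat p" "\<sigma> 1 = m" by (simp_all add: mem_model)
    then show ?case using start bound_Ev[OF start]
      by (intro exI[of _ "[\<sigma> 0, \<sigma> 1, list_encode [], list_encode [m], d0, y0]"])
        (auto simp: mem_model codes)
  qed
next
  case 4 show ?case by (rule sat_datalogI) (auto simp: mem_model)
next
  case 5 show ?case by (rule sat_datalogI) (auto simp: mem_model)
next
  case 6 show ?case by (rule sat_datalogI) (auto simp: mem_model)
next
  case 7
  show ?case
  proof (rule satI, goal_cases)
    case (1 \<sigma>)
    then show ?case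
      \<comment> \<open>\<open>Same\<close> is equality in this model, so the given predecessor
        serves both sides.\<close>
      by (intro exI[of _ "[\<sigma> 0, \<sigma> 1, \<sigma> 2, \<sigma> 2]"]) (auto simp: mem_model)
  qed
next
  case 8 show ?case
    by (rule sat_datalogI) (auto simp: mem_model codes dest!: mem_progD elim!: T_cases)
next
  \<comment> \<open>A denial rule: stuck calls are never justified, so its body has no
    match.\<close>
  case 9 show ?case
    by (rule sat_datalogI) (auto simp: mem_model codes dest!: mem_progD elim!: T_cases)
next
  case 10 show ?case
    by (rule sat_datalogI) (auto simp: mem_model codes dest!: mem_progD elim!: T_cases)
next
  case 11 show ?case
  proof (rule sat_datalogI, goal_cases)
    case (1 \<sigma>)
    then have "Ev (\<sigma> 0) Succ [\<sigma> 4] (\<sigma> 3) \<in> T"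
      by (auto simp: mem_model codes dest!: mem_progD)
    with bound_Ev[OF this] show ?case by (auto simp: mem_model elim!: T_cases)
  qed
next
  case 12 show ?case
    by (rule sat_datalogI) (auto simp: mem_model codes dest!: mem_progD elim!: T_cases)
next
  case 13 show ?case
  proof (rule sat_datalogI, goal_cases)
    case (1 \<sigma>)
    then obtain ns where "Ev (\<sigma> 0) (Proj 0) (\<sigma> 4 # ns) (\<sigma> 3) \<in> T"
      by (auto simp: mem_model codes dest!: mem_progD)
    with bound_Ev[OF this] show ?case by (auto simp: mem_model elim!: T_cases)
  qed
next
  case 14 show ?case
    by (rule sat_datalogI) (auto simp: mem_model codes dest!: mem_progD elim!: T_cases)
next
  case 15
  show ?case
  proof (rule satI, goal_cases)
    case (1 \<sigma>)
    then obtain i ns where eq: "\<sigma> 4 = to_nat (Proj i)" "\<sigma> 6 = list_encode ns"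
      and ev: "Ev (\<sigma> 0) (Proj (Suc i)) (\<sigma> 5 # ns) (\<sigma> 3) \<in> T"
      by (auto simp: mem_model codes dest!: mem_progD)
    from just[OF ev] obtain d where "d < \<sigma> 0" "Ev d (Proj i) ns (\<sigma> 3) \<in> T"
      by (auto elim: justifiedE)
    with eq bound_Ev[OF ev] show ?case
      by (intro exI[of _ "[\<sigma> 0, \<sigma> 1, \<sigma> 2, \<sigma> 3, \<sigma> 4, \<sigma> 5, \<sigma> 6, d]"]) (auto simp: mem_model codes)
  qed
next
  case 16
  show ?case
  proof (rule satI, goal_cases)
    case (1 \<sigma>)
    then obtain f gs ns where eq: "\<sigma> 4 = to_nat f" "\<sigma> 5 = to_nat gs" "\<sigma> 2 = list_encode ns"
      and ev: "Ev (\<sigma> 0) (Comp f gs) ns (\<sigma> 3) \<in> T"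
      by (auto simp: mem_model codes dest!: mem_progD)
    from just[OF ev] obtain d' d'' ms where "d' < \<sigma> 0" "Evs d' gs ns ms \<in> T"
        "d'' < \<sigma> 0" "Ev d'' f ms (\<sigma> 3) \<in> T"
      by (auto elim: justifiedE)
    with eq bound_Ev[OF ev] show ?case
      by (intro exI[of _ "[\<sigma> 0, \<sigma> 1, \<sigma> 2, \<sigma> 3, \<sigma> 4, \<sigma> 5, d', d'', list_encode ms]"])
        (auto simp: mem_model codes)
  qed
next
  case 17 show ?case
    by (rule sat_datalogI) (auto simp: mem_model codes dest!: mem_progD elim!: T_cases)
next
  case 18
  show ?case
  proof (rule satI, goal_cases)
    case (1 \<sigma>)
    then obtain g gs ns ms where
      eq: "\<sigma> 4 = to_nat g" "\<sigma> 5 = to_nat gs" "\<sigma> 2 = list_encode ns" "\<sigma> 3 = list_encode ms"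
      and ev: "Evs (\<sigma> 0) (g # gs) ns ms \<in> T"
      by (auto simp: mem_model codes dest!: mem_progD)
    from just[OF ev] obtain d' d'' y ms' where "d' < \<sigma> 0" "Ev d' g ns y \<in> T"
        "d'' < \<sigma> 0" "Evs d'' gs ns ms' \<in> T" "ms = y # ms'"
      by (auto elim: justifiedE)
    with eq bound_Evs[OF ev] show ?case
      by (intro exI[of _ "[\<sigma> 0, \<sigma> 1, \<sigma> 2, \<sigma> 3, \<sigma> 4, \<sigma> 5, d', d'', y, list_encode ms']"])
        (auto simp: mem_model codes)
  qed
next
  case 19 show ?case
    by (rule sat_datalogI) (auto simp: mem_model codes dest!: mem_progD elim!: T_cases)
next
  case 20
  show ?case
  proof (rule satI, goal_cases)
    case (1 \<sigma>)
    then obtain f g ns where eq: "\<sigma> 4 = to_nat f" "\<sigma> 6 = 0" "\<sigma> 7 = list_encode ns"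
      and ev: "Ev (\<sigma> 0) (PrimRec f g) (0 # ns) (\<sigma> 3) \<in> T"
      by (auto simp: mem_model codes dest!: mem_progD)
    from just[OF ev] obtain d where "d < \<sigma> 0" "Ev d f ns (\<sigma> 3) \<in> T"
      by (auto elim: justifiedE)
    with eq bound_Ev[OF ev] show ?case
      by (intro exI[of _ "[\<sigma> 0, \<sigma> 1, \<sigma> 2, \<sigma> 3, \<sigma> 4, \<sigma> 5, \<sigma> 6, \<sigma> 7, d]"])
        (auto simp: mem_model codes)
  qed
next
  case 21
  show ?case
  proof (rule satI, goal_cases)
    case (1 \<sigma>)
    then obtain f g ns where
      eq: "\<sigma> 1 = to_nat (PrimRec f g)" "\<sigma> 5 = to_nat g" "\<sigma> 7 = list_encode ns"
      and ev: "Ev (\<sigma> 0) (PrimRec f g) (Suc (\<sigma> 8) # ns) (\<sigma> 3) \<in> T"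
      by (auto simp: mem_model codes dest!: mem_progD)
    from just[OF ev] obtain d' d'' r where
      d': "d' < \<sigma> 0" "Ev d' (PrimRec f g) (\<sigma> 8 # ns) r \<in> T"
      and d'': "d'' < \<sigma> 0" "Ev d'' g (\<sigma> 8 # r # ns) (\<sigma> 3) \<in> T"
      by (auto elim: justifiedE)
    \<comment> \<open>This list occurs in no premise itself, but it is the tail of the argument list
      of \<open>g\<close>.\<close>
    have "list_encode (r # ns) < B"
      using bound_Ev[OF d''(2)] list_encode_Cons(2)[of "r # ns" "\<sigma> 8"] by linarith
    with eq d' d'' bound_Ev[OF ev] bound_Ev[OF d'(2)] bound_Ev[OF d''(2)] show ?case
      by (intro exI[of _ "[\<sigma> 0, \<sigma> 1, \<sigma> 2, \<sigma> 3, \<sigma> 4, \<sigma> 5, \<sigma> 6, \<sigma> 7, \<sigma> 8, d', d'',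
          list_encode (\<sigma> 8 # ns), list_encode (r # ns), list_encode (\<sigma> 8 # r # ns), r]"])
        (auto simp: mem_model codes)
  qed
next
  case 22
  show ?case
  proof (rule satI, goal_cases)
    case (1 \<sigma>)
    then obtain f ns where eq: "\<sigma> 4 = to_nat f" "\<sigma> 2 = list_encode ns"
      and ev: "Ev (\<sigma> 0) (Mu f) ns (\<sigma> 3) \<in> T"
      by (auto simp: mem_model codes dest!: mem_progD)
    from just[OF ev] obtain d v where "d < \<sigma> 0" "Srch d f 0 ns v (\<sigma> 3) \<in> T"
      by (auto elim: justifiedE)
    with eq bound_Ev[OF ev] show ?case
      by (intro exI[of _ "[\<sigma> 0, \<sigma> 1, \<sigma> 2, \<sigma> 3, \<sigma> 4, d, 0, v]"]) (auto simp: mem_model codes)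
  qed
next
  case 23
  show ?case
  proof (rule satI, goal_cases)
    case (1 \<sigma>)
    then obtain f ns where eq: "\<sigma> 1 = to_nat f" "\<sigma> 3 = list_encode ns"
      and ev: "Srch (\<sigma> 0) f (\<sigma> 2) ns (\<sigma> 4) (\<sigma> 5) \<in> T"
      by (auto simp: mem_model codes dest!: mem_progD)
    from just[OF ev] obtain d where d: "d < \<sigma> 0" "Ev d f (\<sigma> 2 # ns) (\<sigma> 4) \<in> T"
      by (auto elim: justifiedE)
    with eq bound_Srch[OF ev] bound_Ev[OF d(2)] show ?case
      by (intro exI[of _ "[\<sigma> 0, \<sigma> 1, \<sigma> 2, \<sigma> 3, \<sigma> 4, \<sigma> 5, d, list_encode (\<sigma> 2 # ns)]"])
        (auto simp: mem_model codes)
  qed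
next
  case 24 show ?case
  proof (rule sat_datalogI, goal_cases)
    case (1 \<sigma>)
    then obtain f ns where "Srch (\<sigma> 0) f (\<sigma> 2) ns 0 (\<sigma> 5) \<in> T"
      by (auto simp: mem_model codes)
    with bound_Srch[OF this] show ?case by (auto simp: mem_model elim!: T_cases)
  qed
next
  case 25
  show ?case
  proof (rule satI, goal_cases)
    case (1 \<sigma>)
    then obtain f ns where eq: "\<sigma> 1 = to_nat f" "\<sigma> 3 = list_encode ns"
      and ev: "Srch (\<sigma> 0) f (\<sigma> 2) ns (Suc (\<sigma> 6)) (\<sigma> 5) \<in> T"
      by (auto simp: mem_model codes)
    from just[OF ev] obtain d w where d: "d < \<sigma> 0" "Srch d f (Suc (\<sigma> 2)) ns w (\<sigma> 5) \<in> T"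
      by (auto elim: justifiedE)
    \<comment> \<open>The next search item bounds \<open>Suc (\<sigma> 2)\<close> by
      \<open>B\<close>, so the required \<open>NSuc\<close> fact survives the cut-off.\<close>
    with eq 1 bound_Srch[OF ev] bound_Srch[OF d(2)] show ?case
      by (intro exI[of _ "[\<sigma> 0, \<sigma> 1, \<sigma> 2, \<sigma> 3, \<sigma> 4, \<sigma> 5, \<sigma> 6, d, Suc (\<sigma> 2), w]"])
        (auto simp: mem_model codes)
  qed
qed simp

lemma arity_model: "(r, vs) \<in> model \<Longrightarrow> length vs = arity r"
  by (auto simp: model_def number_facts_def static_facts_def input_facts_def
    arity_item_fact arity_prog_fact dest!: prog_fact_prog_facts(1))

end

text \<open>The last property ensures that the model changes nothing outside the scope of the first
  procedure.\<close>

lemma halts_model: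
  assumes "rec_eval p [m] y"
  obtains F where "finite F" "list_all (sat F) rules" "static_facts p \<union> input_facts m \<subseteq> F"
    and "\<And>r vs. (r, vs) \<in> F \<Longrightarrow> length vs = arity r"
    and "\<And>r vs. (r, vs) \<in> F \<Longrightarrow> r \<notin> derived_syms \<Longrightarrow> (r, vs) \<in> static_facts p \<union> input_facts m"
proof -
  from derivable_rec_eval[OF assms] obtain T d
    where T: "finite T" "closed T" "Ev d p [m] y \<in> T"
    unfolding derivable_def by blast
  have "finite (\<Union>it \<in> T. set (snd (item_fact it)))" using T(1) by simp
  then obtain B where "\<forall>v \<in> (\<Union>it \<in> T. set (snd (item_fact it))). v < B"
    using finite_nat_set_iff_bounded by blast
  with T interpret computation p m T B d y by unfold_locales auto
  show ?thesis
  proof (rule that[OF finite_model sat_model])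
    show "static_facts p \<union> input_facts m \<subseteq> model" by (auto simp: model_def)
    show "(r, vs) \<in> static_facts p \<union> input_facts m" if "(r, vs) \<in> model" "r \<notin> derived_syms" for r vs
      using that by (auto simp: model_def number_facts_def item_fact_not derived_syms_def)
  qed (rule arity_model)
qed

section \<open>Reduction of the halting problem\<close>

instance sym :: countable by countable_datatype

instance sym :: finite
proof
  have "UNIV = {Bot, Main, InZero, InSuc, Input, PZero, PSucc, PProj0, PProjS, PComp, PNil,
      PCons, PRec, PMu, NZero, NSuc, LNil, LCons, Same, Less, Eval, Evals, Search}"
    by (rule set_eqI) (case_tac x; simp)
  then show "finite (UNIV :: sym set)" by (metis finite.emptyI finite_insert)
qed

section \<open>Sets of facts as database instances\<close>

definition rel_of :: "sym \<Rightarrow> relname" where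
  "rel_of r = Rel (to_nat r)"

lemma inj_rel_of: "inj rel_of"
  by (rule injI) (simp add: rel_of_def to_nat_eq_iff)

lemma rel_of_eq_iff: "rel_of r = rel_of s \<longleftrightarrow> r = s"
  using inj_rel_of by (simp add: inj_eq)

definition eval_schema :: schema where
  "eval_schema R = (if R \<in> range rel_of then Some (Attr ` {..<arity (inv rel_of R)}) else None)"

lemma eval_schema_rel_of: "eval_schema (rel_of r) = Some (Attr ` {..<arity r})"
  by (simp add: eval_schema_def inv_f_f[OF inj_rel_of])

lemma dom_eval_schema: "dom eval_schema = range rel_of"
  by (auto simp: eval_schema_def dom_def)

lemma is_schema_eval_schema: "is_schema eval_schema"
  unfolding is_schema_def dom_eval_schema by (auto simp: ran_def eval_schema_def split: if_splits)

definition tup_of :: "nat list \<Rightarrow> tup" where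
  "tup_of vs = (\<lambda>A. if attr_idx A < length vs then Some (Val (vs ! attr_idx A)) else None)"

lemma dom_tup_of: "dom (tup_of vs) = Attr ` {..<length vs}"
proof (rule set_eqI)
  fix A show "A \<in> dom (tup_of vs) \<longleftrightarrow> A \<in> Attr ` {..<length vs}"
    by (cases A) (auto simp: tup_of_def dom_def)
qed

lemma tup_of_Attr: "i < length vs \<Longrightarrow> tup_of vs (Attr i) = Some (Val (vs ! i))"
  by (simp add: tup_of_def)

lemma inj_tup_of: "inj tup_of"
proof (rule injI)
  fix vs ws assume eq: "tup_of vs = tup_of ws"
  have "i < length vs \<longleftrightarrow> i < length ws" for i
    using fun_cong[OF eq, of "Attr i"] by (auto simp: tup_of_def split: if_splits)
  then have len: "length vs = length ws" by (metis linorder_neqE_nat less_irrefl)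
  show "vs = ws"
  proof (rule nth_equalityI[OF len])
    fix i assume "i < length vs"
    then show "vs ! i = ws ! i"
      using fun_cong[OF eq, of "Attr i"] len by (simp add: tup_of_def)
  qed
qed

lemma tup_ofI:
  assumes "dom t = Attr ` {..<length vs}" "\<And>i. i < length vs \<Longrightarrow> t (Attr i) = Some (Val (vs ! i))"
  shows "t = tup_of vs"
proof (rule ext)
  fix A show "t A = tup_of vs A"
  proof (cases "A \<in> dom t")
    case True then show ?thesis using assms by (auto simp: tup_of_Attr)
  next
    case False
    then have "A \<notin> dom (tup_of vs)" using assms(1) dom_tup_of by simp
    with False show ?thesis by (simp add: domIff)
  qed
qed

definition inst_of :: "fact set \<Rightarrow> inst" where
  "inst_of F R = {tup_of vs | r vs. R = rel_of r \<and> (r, vs) \<in> F}"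

definition facts_of :: "inst \<Rightarrow> fact set" where
  "facts_of I = {(r, vs). tup_of vs \<in> I (rel_of r)}"

lemma tup_of_mem_inst_of: "tup_of vs \<in> inst_of F (rel_of r) \<longleftrightarrow> (r, vs) \<in> F"
  by (auto simp: inst_of_def rel_of_eq_iff inj_eq[OF inj_tup_of])

lemma facts_of_inst_of: "facts_of (inst_of F) = F"
  by (auto simp: facts_of_def tup_of_mem_inst_of)

lemma is_instance_inst_of:
  assumes "finite F" "\<And>r vs. (r, vs) \<in> F \<Longrightarrow> length vs = arity r"
  shows "is_instance eval_schema (inst_of F)"
  unfolding is_instance_def
proof (intro conjI ballI allI impI)
  show "is_schema eval_schema" by (rule is_schema_eval_schema)
next
  fix R
  have "inst_of F R \<subseteq> (\<lambda>a. tup_of (snd a)) ` F" by (force simp: inst_of_def)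
  then show "finite (inst_of F R)" using assms(1) by (meson finite_imageI finite_subset)
next
  fix R t assume "t \<in> inst_of F R"
  then obtain r vs where "R = rel_of r" "t = tup_of vs" "(r, vs) \<in> F"
    by (auto simp: inst_of_def)
  then show "dom t = the (eval_schema R)"
    using assms(2) by (simp add: eval_schema_rel_of dom_tup_of)
next
  fix R assume "R \<notin> dom eval_schema"
  then show "inst_of F R = {}" by (auto simp: inst_of_def dom_eval_schema)
qed

lemma finite_facts_of:
  assumes "is_instance eval_schema I" shows "finite (facts_of I)"
proof -
  have "facts_of I = (SIGMA r:UNIV. tup_of -` I (rel_of r))" by (auto simp: facts_of_def)
  moreover have "finite (I (rel_of r))" for r
    using assms by (auto simp: is_instance_def dom_eval_schema)
  ultimately show ?thesis by (simp add: finite_vimageI inj_tup_of)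
qed

section \<open>Rules as tgds\<close>

fun atom_of :: "fact \<Rightarrow> atom" where
  "atom_of (r, xs) = Atom (rel_of r) (zip (map Attr [0..<length xs]) xs)"

abbreviation vars_of :: "fact list \<Rightarrow> var list" where
  "vars_of \<phi> \<equiv> concat (map snd \<phi>)"

text \<open>Frontier variables of a well-formed tgd occur on both sides, hence the filter; the
  remaining body variables are existential in the body.\<close>

fun tgd_of :: "rule \<Rightarrow> dependency" where
  "tgd_of (\<phi>, \<psi>) = TGD (filter (\<lambda>x. x \<in> set (vars_of \<psi>)) (vars_of \<phi>)) (map atom_of \<phi>) (map atom_of \<psi>)"

fun wf_rule :: "rule \<Rightarrow> bool" where
  "wf_rule (\<phi>, \<psi>) \<longleftrightarrow> \<phi> \<noteq> [] \<and> \<psi> \<noteq> [] \<and> (\<forall>(r, xs) \<in> set \<phi> \<union> set \<psi>. length xs = arity r)"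

lemma atom_vars_atom_of: "atom_vars (atom_of (r, xs)) = set xs"
  by (simp add: atom_vars_def set_map[symmetric] del: set_map)

lemma wf_atom_atom_of: "wf_atom (atom_of (r, xs))"
  by (simp add: wf_atom_def distinct_map inj_on_def)

lemma wf_dep_tgd_of: "wf_rule \<rho> \<Longrightarrow> wf_dep (tgd_of \<rho>)"
  by (cases \<rho>) (force simp: wf_cq_def wf_atom_atom_of atom_vars_atom_of simp del: atom_of.simps)

lemma is_tgd_tgd_of: "is_tgd (tgd_of \<rho>)"
  by (cases \<rho>) simp

lemma atom_compatible_atom_of:
  "length xs = arity r \<Longrightarrow> atom_compatible eval_schema (atom_of (r, xs))"
  by (auto simp: atom_compatible_def eval_schema_rel_of dest!: set_zip_leftD)

lemma dep_cqs_tgd_of: "wf_rule \<rho> \<Longrightarrow> q \<in> dep_cqs (tgd_of \<rho>) \<Longrightarrow> cq_compatible eval_schema q"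
  by (cases \<rho>)
    (fastforce simp: cq_compatible_def intro!: atom_compatible_atom_of simp del: atom_of.simps)

text \<open>The atom mentions every attribute of its relation, so the assignment determines the
  matching tuple completely.\<close>

lemma sat_atom_atom_of:
  assumes I: "is_instance eval_schema I" and len: "length xs = arity r"
  shows "sat_atom I \<tau> (atom_of (r, xs)) \<longleftrightarrow> (r, map (val_idx \<circ> \<tau>) xs) \<in> facts_of I"
proof
  assume "sat_atom I \<tau> (atom_of (r, xs))"
  then obtain t where t: "t \<in> I (rel_of r)"
      "\<And>A x. (A, x) \<in> set (zip (map Attr [0..<length xs]) xs) \<Longrightarrow> t A = Some (\<tau> x)"
    by (auto simp: sat_atom_def)
  have "t = tup_of (map (val_idx \<circ> \<tau>) xs)"
  proof (rule tup_ofI)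
    have "rel_of r \<in> dom eval_schema" by (simp add: dom_eval_schema)
    with I t(1) have "dom t = the (eval_schema (rel_of r))" by (simp add: is_instance_def)
    then show "dom t = Attr ` {..<length (map (val_idx \<circ> \<tau>) xs)}"
      using len by (simp add: eval_schema_rel_of)
    fix i assume i: "i < length (map (val_idx \<circ> \<tau>) xs)"
    then have "(Attr i, xs ! i) \<in> set (zip (map Attr [0..<length xs]) xs)"
      by (auto simp: set_zip intro!: exI[of _ i])
    from t(2)[OF this] i show "t (Attr i) = Some (Val (map (val_idx \<circ> \<tau>) xs ! i))" by simp
  qed
  with t(1) show "(r, map (val_idx \<circ> \<tau>) xs) \<in> facts_of I" by (simp add: facts_of_def)
next
  assume "(r, map (val_idx \<circ> \<tau>) xs) \<in> facts_of I"
  then have "tup_of (map (val_idx \<circ> \<tau>) xs) \<in> I (rel_of r)" by (simp add: facts_of_def)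
  then show "sat_atom I \<tau> (atom_of (r, xs))"
    unfolding sat_atom_def
    by (intro bexI[of _ "tup_of (map (val_idx \<circ> \<tau>) xs)"]) (auto simp: set_zip tup_of_Attr)
qed

lemma dep_holds_tgd_of:
  assumes I: "is_instance eval_schema I" and wf: "wf_rule \<rho>"
  shows "dep_holds I (tgd_of \<rho>) \<longleftrightarrow> sat (facts_of I) \<rho>"
proof -
  obtain \<phi> \<psi> where \<rho>: "\<rho> = (\<phi>, \<psi>)" by (cases \<rho>)
  define ys where "ys = filter (\<lambda>x. x \<in> set (vars_of \<psi>)) (vars_of \<phi>)"
  define holds where
    "holds \<chi> \<tau> \<longleftrightarrow> (\<forall>(r, xs) \<in> set \<chi>. (r, map \<tau> xs) \<in> facts_of I)" for \<chi> :: "fact list" and \<tau>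
  have atoms: "(\<forall>a \<in> set (map atom_of \<chi>). sat_atom I \<tau> a) \<longleftrightarrow> holds \<chi> (val_idx \<circ> \<tau>)"
    if "\<chi> = \<phi> \<or> \<chi> = \<psi>" for \<chi> \<tau>
  proof -
    have len: "length xs = arity r" if "(r, xs) \<in> set \<chi>" for r xs
      using wf \<open>(r, xs) \<in> set \<chi>\<close> \<open>\<chi> = \<phi> \<or> \<chi> = \<psi>\<close> unfolding \<rho> wf_rule.simps by blast
    have "sat_atom I \<tau> (atom_of a) \<longleftrightarrow> (case a of (r, xs) \<Rightarrow> (r, map (val_idx \<circ> \<tau>) xs) \<in> facts_of I)"
      if "a \<in> set \<chi>" for a
      using sat_atom_atom_of[OF I len] that by (cases a) simp
    then show ?thesis unfolding holds_def by simp
  qed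
  have dep: "dep_holds I (tgd_of \<rho>) \<longleftrightarrow>
      (\<forall>\<tau>. (\<exists>\<sigma>. (\<forall>y \<in> set ys. \<sigma> y = \<tau> y) \<and> holds \<phi> (val_idx \<circ> \<sigma>)) \<longrightarrow>
        (\<exists>\<sigma>. (\<forall>y \<in> set ys. \<sigma> y = \<tau> y) \<and> holds \<psi> (val_idx \<circ> \<sigma>)))"
    unfolding \<rho> tgd_of.simps dep_holds.simps sat_cq_def cq.sel ys_def[symmetric]
    by (simp only: atoms simp_thms)
  have sat: "sat (facts_of I) \<rho> \<longleftrightarrow> (\<forall>\<sigma>. holds \<phi> \<sigma> \<longrightarrow>
      (\<exists>\<sigma>'. (\<forall>x \<in> set (vars_of \<phi>). \<sigma>' x = \<sigma> x) \<and> holds \<psi> \<sigma>'))"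
    unfolding \<rho> sat.simps holds_def by (simp add: case_prod_beta)
  show ?thesis unfolding dep sat
  proof (intro iffI allI impI)
    fix \<sigma> assume H: "\<forall>\<tau>. (\<exists>\<sigma>. (\<forall>y \<in> set ys. \<sigma> y = \<tau> y) \<and> holds \<phi> (val_idx \<circ> \<sigma>)) \<longrightarrow>
        (\<exists>\<sigma>. (\<forall>y \<in> set ys. \<sigma> y = \<tau> y) \<and> holds \<psi> (val_idx \<circ> \<sigma>))"
      and \<sigma>: "holds \<phi> \<sigma>"
    have "holds \<phi> (val_idx \<circ> (Val \<circ> \<sigma>))" using \<sigma> by (simp add: comp_def)
    with H obtain \<sigma>' where \<sigma>': "\<forall>y \<in> set ys. \<sigma>' y = Val (\<sigma> y)" "holds \<psi> (val_idx \<circ> \<sigma>')"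
      by (metis comp_apply)
    \<comment> \<open>The tgd fixes the head assignment only on the frontier. Resetting it to
      \<open>\<sigma>\<close> on all body variables changes nothing on the variables of the
      head.\<close>
    define \<mu> where "\<mu> x = (if x \<in> set (vars_of \<phi>) then \<sigma> x else val_idx (\<sigma>' x))" for x
    have "\<mu> x = val_idx (\<sigma>' x)" if "x \<in> set (vars_of \<psi>)" for x
      using that \<sigma>'(1) by (auto simp: \<mu>_def ys_def)
    then have eq: "map \<mu> xs = map (val_idx \<circ> \<sigma>') xs" if "(r, xs) \<in> set \<psi>" for r xs
      using that by fastforce
    have "holds \<psi> \<mu>"
      unfolding holds_def
    proof clarify
      fix r xs assume mem: "(r, xs) \<in> set \<psi>"
      then have "(r, map (val_idx \<circ> \<sigma>') xs) \<in> facts_of I"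
        using \<sigma>'(2) unfolding holds_def by blast
      then show "(r, map \<mu> xs) \<in> facts_of I" by (simp only: eq[OF mem])
    qed
    then show "\<exists>\<sigma>'. (\<forall>x \<in> set (vars_of \<phi>). \<sigma>' x = \<sigma> x) \<and> holds \<psi> \<sigma>'"
      by (intro exI[of _ \<mu>]) (simp add: \<mu>_def)
  next
    fix \<tau> assume H: "\<forall>\<sigma>. holds \<phi> \<sigma> \<longrightarrow>
        (\<exists>\<sigma>'. (\<forall>x \<in> set (vars_of \<phi>). \<sigma>' x = \<sigma> x) \<and> holds \<psi> \<sigma>')"
      and "\<exists>\<sigma>. (\<forall>y \<in> set ys. \<sigma> y = \<tau> y) \<and> holds \<phi> (val_idx \<circ> \<sigma>)"
    then obtain \<sigma> where \<sigma>: "\<forall>y \<in> set ys. \<sigma> y = \<tau> y" "holds \<phi> (val_idx \<circ> \<sigma>)" by blast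
    with H obtain \<sigma>' where \<sigma>': "\<forall>x \<in> set (vars_of \<phi>). \<sigma>' x = val_idx (\<sigma> x)" "holds \<psi> \<sigma>'"
      by (metis comp_apply)
    have "\<forall>y \<in> set ys. (Val \<circ> \<sigma>') y = \<tau> y"
      using \<sigma>(1) \<sigma>'(1) by (auto simp: ys_def)
    moreover have "holds \<psi> (val_idx \<circ> (Val \<circ> \<sigma>'))" using \<sigma>'(2) by (simp add: comp_def)
    ultimately show "\<exists>\<sigma>. (\<forall>y \<in> set ys. \<sigma> y = \<tau> y) \<and> holds \<psi> (val_idx \<circ> \<sigma>)" by blast
  qed
qed

lemma models_tgd_of:
  assumes "is_instance eval_schema I" "\<forall>\<rho> \<in> X. wf_rule \<rho>"
  shows "models eval_schema I (tgd_of ` X) \<longleftrightarrow> (\<forall>\<rho> \<in> X. sat (facts_of I) \<rho>)"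
proof -
  have "(\<forall>q \<in> dep_cqs (tgd_of \<rho>). cq_compatible eval_schema q) \<and> dep_holds I (tgd_of \<rho>)
      \<longleftrightarrow> sat (facts_of I) \<rho>" if "\<rho> \<in> X" for \<rho>
    using that assms dep_cqs_tgd_of dep_holds_tgd_of by blast
  then show ?thesis by (simp add: models_def)
qed

lemma wf_rules: "\<forall>\<rho> \<in> set rules. wf_rule \<rho>"
  by (simp add: rules_def)

section \<open>The two procedures and their outcomes\<close>

definition eval_proc :: procedure where
  "eval_proc = \<lparr>scope = OnAll ` rel_of ` derived_syms, pre = {}, post = tgd_of ` set rules, pres = {}\<rparr>"

text \<open>Every input instance has a \<open>Main\<close> fact and an empty \<open>Bot\<close>, and
  outcomes of \<open>eval_proc\<close> inherit both, so each of them violates this rule.\<close>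

definition bot_rule :: rule where
  "bot_rule = ([(Main, [0])], [(Bot, [])])"

definition bot_proc :: procedure where
  "bot_proc = \<lparr>scope = {}, pre = tgd_of ` {bot_rule}, post = {}, pres = {}\<rparr>"

lemma wf_bot_rule: "wf_rule bot_rule"
  by (simp add: bot_rule_def)

lemma procedures:
  "wf_procedure eval_proc" "wf_procedure bot_proc" "only_tgds eval_proc" "only_tgds bot_proc"
  using wf_rules wf_bot_rule
  by (auto simp: wf_procedure_def only_tgds_def eval_proc_def bot_proc_def wf_dep_tgd_of is_tgd_tgd_of)

definition input_inst :: "recf \<Rightarrow> nat \<Rightarrow> inst" where
  "input_inst p m = inst_of (static_facts p \<union> input_facts m)"

lemma is_instance_input_inst: "is_instance eval_schema (input_inst p m)"
  unfolding input_inst_def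
proof (rule is_instance_inst_of)
  show "finite (static_facts p \<union> input_facts m)"
    by (simp add: static_facts_def input_facts_def finite_prog_facts)
  show "length vs = arity r" if "(r, vs) \<in> static_facts p \<union> input_facts m" for r vs
    using that arity_prog_fact[OF prog_fact_prog_facts(1)]
    by (auto simp: static_facts_def input_facts_def)
qed

lemma agree_outside_scope_eval_proc:
  "agree_outside_scope (scope eval_proc) eval_schema I I' \<longleftrightarrow>
     (\<forall>r. r \<notin> derived_syms \<longrightarrow> I (rel_of r) = I' (rel_of r))"
  by (auto simp: agree_outside_scope_def eval_proc_def dom_eval_schema image_iff rel_of_eq_iff)

text \<open>An outcome is a finite model of the rules that contains the stored facts, and its
  \<open>Bot\<close> is empty because \<open>Bot\<close> lies outside the scope. Hence it certifies
  halting and violates \<open>bot_rule\<close>.\<close>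

lemma outcome_eval_proc:
  assumes "I' \<in> outcomes eval_proc eval_schema (input_inst p m)"
  shows "\<exists>y. rec_eval p [m] y" "\<not> models eval_schema I' (pre bot_proc)"
proof -
  have I': "is_instance eval_schema I'" and post: "models eval_schema I' (post eval_proc)"
    and agree: "\<And>r. r \<notin> derived_syms \<Longrightarrow> input_inst p m (rel_of r) = I' (rel_of r)"
    using assms by (auto simp: outcomes_def agree_outside_scope_eval_proc)
  have facts: "(r, vs) \<in> facts_of I' \<longleftrightarrow> (r, vs) \<in> static_facts p \<union> input_facts m"
    if "r \<notin> derived_syms" for r vs
  proof -
    have "(r, vs) \<in> facts_of I' \<longleftrightarrow> tup_of vs \<in> input_inst p m (rel_of r)"
      by (simp add: facts_of_def agree[OF that])
    then show ?thesis by (simp only: input_inst_def tup_of_mem_inst_of)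
  qed
  have sub: "static_facts p \<union> input_facts m \<subseteq> facts_of I'"
  proof
    fix a assume a: "a \<in> static_facts p \<union> input_facts m"
    moreover have "fst a \<notin> derived_syms"
      using a prog_fact_prog_facts(1)[of a p]
      by (cases a) (auto simp: static_facts_def input_facts_def derived_syms_def)
    ultimately show "a \<in> facts_of I'" using facts by (cases a) auto
  qed
  have no_Bot: "(Bot, []) \<notin> facts_of I'"
    using facts[of Bot "[]"] prog_fact_prog_facts(1)[of "(Bot, [])" p]
    by (auto simp: derived_syms_def static_facts_def input_facts_def)
  have "\<forall>\<rho> \<in> set rules. sat (facts_of I') \<rho>"
    using post models_tgd_of[OF I' wf_rules] by (simp add: eval_proc_def)
  then interpret finite_model "facts_of I'"
    using finite_facts_of[OF I'] no_Bot by unfold_locales auto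
  show "\<exists>y. rec_eval p [m] y" by (rule model_halts[OF sub])
  have "(Main, [to_nat p]) \<in> facts_of I'" using sub by (auto simp: static_facts_def)
  with no_Bot have "\<not> sat (facts_of I') bot_rule"
    by (auto simp: bot_rule_def intro!: exI[of _ "\<lambda>_. to_nat p"])
  then show "\<not> models eval_schema I' (pre bot_proc)"
    using models_tgd_of[OF I', of "{bot_rule}"] wf_bot_rule by (simp add: bot_proc_def)
qed

lemma outcome_eval_proc_ex:
  assumes "rec_eval p [m] y"
  shows "\<exists>I'. I' \<in> outcomes eval_proc eval_schema (input_inst p m)"
proof -
  from halts_model[OF assms] obtain F where F: "finite F" "list_all (sat F) rules"
      "static_facts p \<union> input_facts m \<subseteq> F" "\<And>r vs. (r, vs) \<in> F \<Longrightarrow> length vs = arity r"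
      "\<And>r vs. (r, vs) \<in> F \<Longrightarrow> r \<notin> derived_syms \<Longrightarrow> (r, vs) \<in> static_facts p \<union> input_facts m"
    by blast
  have inst: "is_instance eval_schema (inst_of F)" by (rule is_instance_inst_of[OF F(1,4)])
  have "models eval_schema (inst_of F) (post eval_proc)"
    using F(2) models_tgd_of[OF inst wf_rules]
    by (simp add: eval_proc_def facts_of_inst_of list_all_iff)
  moreover have "input_inst p m (rel_of r) = inst_of F (rel_of r)" if "r \<notin> derived_syms" for r
    using F(3,5) that by (auto simp: input_inst_def inst_of_def rel_of_eq_iff)
  ultimately have "inst_of F \<in> outcomes eval_proc eval_schema (input_inst p m)"
    using inst unfolding outcomes_def agree_outside_scope_eval_proc
    by (simp add: applicable_def models_def eval_proc_def)
  then show ?thesis by blast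
qed

text \<open>If \<open>p\<close> halts, some outcome exists and violates the precondition; otherwise
  there is no outcome and the universal statement is vacuous.\<close>

lemma outcomes_iff_halts:
  "(\<forall>I' \<in> outcomes eval_proc eval_schema (input_inst p m). models eval_schema I' (pre bot_proc))
     \<longleftrightarrow> \<not> (\<exists>y. rec_eval p [m] y)"
  using outcome_eval_proc outcome_eval_proc_ex by blast

section \<open>Computability of the codes of input instances\<close>

fun fact_code :: "fact \<Rightarrow> nat" where
  "fact_code (r, vs) = prod_encode (to_nat r, tuple_code (tup_of vs))"

lemma inj_fact_code: "inj fact_code"
proof (rule injI)
  fix a b assume "fact_code a = fact_code b"
  then have "fst a = fst b" "tuple_code (tup_of (snd a)) = tuple_code (tup_of (snd b))"
    by (cases a; cases b; simp add: prod_encode_eq to_nat_eq_iff)+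
  moreover from this(2) have "tup_of (snd a) = tup_of (snd b)"
    by (intro tuple_code_inj) (simp_all add: dom_tup_of)
  ultimately show "a = b" using inj_tup_of by (simp add: inj_eq prod_eq_iff)
qed

text \<open>\<open>set_encode\<close> of the fact codes, as a sum that is additive over disjoint
  sets of facts.\<close>

definition facts_code :: "fact set \<Rightarrow> nat" where
  "facts_code F = (\<Sum>a \<in> F. 2 ^ fact_code a)"

lemma inst_code_inst_of: "inst_code (inst_of F) = facts_code F"
proof -
  have "{prod_encode (rel_idx R, tuple_code t) | R t. t \<in> inst_of F R} = fact_code ` F"
    by (force simp: inst_of_def rel_of_def image_iff)
  then have "inst_code (inst_of F) = (\<Sum>n \<in> fact_code ` F. 2 ^ n)"
    by (simp add: inst_code_def set_encode_def)
  also have "\<dots> = facts_code F"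
    unfolding facts_code_def
    by (subst sum.reindex) (auto intro: inj_on_subset[OF inj_fact_code])
  finally show ?thesis .
qed

lemma tuple_code_tup_of: "tuple_code (tup_of vs) = (\<Sum>i<length vs. 2 ^ prod_encode (i, vs ! i))"
proof -
  have "(\<lambda>A. prod_encode (attr_idx A, val_idx (the (tup_of vs A)))) ` dom (tup_of vs)
      = (\<lambda>i. prod_encode (i, vs ! i)) ` {..<length vs}"
    unfolding dom_tup_of image_image by (intro image_cong) (simp_all add: tup_of_Attr)
  moreover have "inj_on (\<lambda>i. prod_encode (i, vs ! i)) {..<length vs}"
    by (simp add: inj_on_def prod_encode_eq)
  ultimately show ?thesis
    by (simp add: tuple_code_def set_encode_def sum.reindex)
qed

lemma computable_facts_code_input: "computable (\<lambda>m. facts_code (input_facts m))"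
proof -
  have "facts_code (input_facts m) =
      2 ^ fact_code (Input, [m]) + (\<Sum>i<m. 2 ^ fact_code (InSuc, [i, Suc i]))" for m
  proof -
    have "inj_on (\<lambda>i. (InSuc, [i, Suc i])) {..<m}" by (simp add: inj_on_def)
    then show ?thesis
      by (subst input_facts_def, simp add: facts_code_def image_iff sum.reindex)
  qed
  then show ?thesis
    \<comment> \<open>Unfolded, the code consists of powers of two of pairings built from constants,
      \<open>m\<close> and the summation index.\<close>
    by (simp add: tuple_code_tup_of computable_add computable_sum computable_pow2
      computable_prod_encode computable_const computable_id computable_Suc)
qed

text \<open>The diagonal program is started on the code of the instance that describes it;
  adding this argument to the instance adds a computable amount to its code.\<close>

lemma input_code_input_inst:
  "input_code (eval_schema, input_inst p m) =
     prod_encode (schema_code eval_schema, facts_code (static_facts p) + facts_code (input_facts m))"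
proof -
  have "static_facts p \<inter> input_facts m = {}"
    using prog_fact_prog_facts(1)[of _ p] by (fastforce simp: static_facts_def input_facts_def)
  then have "facts_code (static_facts p \<union> input_facts m) =
      facts_code (static_facts p) + facts_code (input_facts m)"
    unfolding facts_code_def
    by (intro sum.union_disjoint)
      (auto simp: static_facts_def input_facts_def finite_prog_facts)
  then show ?thesis by (simp add: input_inst_def inst_code_inst_of)
qed

theorem proposition1:
  shows "\<exists>P1 P2. wf_procedure P1 \<and> wf_procedure P2 \<and> only_tgds P1 \<and> only_tgds P2
    \<and> \<not> decidable_problem input_code inputs
          (\<lambda>(S, I). \<forall>I' \<in> outcomes P1 S I. models S I' (pre P2))"
proof (rule exI[of _ eval_proc], rule exI[of _ bot_proc], intro conjI procedures notI)
  assume "decidable_problem input_code inputs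
    (\<lambda>(S, I). \<forall>I' \<in> outcomes eval_proc S I. models S I' (pre bot_proc))"
  then obtain f where f: "\<And>S I. (S, I) \<in> inputs \<Longrightarrow> rec_eval f [input_code (S, I)]
      (if \<forall>I' \<in> outcomes eval_proc S I. models S I' (pre bot_proc) then 1 else 0)"
    unfolding decidable_problem_def by fastforce
  \<comment> \<open>\<open>h m\<close> assumes that \<open>m\<close> is the code of the static part
    and adds the part for the argument \<open>m\<close>.\<close>
  define h where "h m = prod_encode (schema_code eval_schema, m + facts_code (input_facts m))" for m
  have "computable h"
    unfolding h_def
    by (intro computable_prod_encode computable_add computable_const computable_id
      computable_facts_code_input)
  then obtain D where D: "\<And>m. rec_eval f [h m] 1 \<Longrightarrow> \<exists>y. rec_eval D [m] y"
      "\<And>m. rec_eval f [h m] 0 \<Longrightarrow> \<not> (\<exists>y. rec_eval D [m] y)"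
    using diagonal_program[of h f] by blast
  \<comment> \<open>\<open>D\<close> is fixed before \<open>m\<close> is chosen. With this choice,
    \<open>h m\<close> is the code of the instance that asks whether \<open>D\<close> halts on
    \<open>m\<close>.\<close>
  define m where "m = facts_code (static_facts D)"
  have "rec_eval f [h m] (if \<not> (\<exists>y. rec_eval D [m] y) then 1 else 0)"
    using f[of eval_schema "input_inst D m"] is_instance_input_inst[of D m]
    unfolding outcomes_iff_halts input_code_input_inst
    by (simp add: inputs_def h_def m_def)
  \<comment> \<open>The answer is 1 exactly if \<open>D\<close> diverges on \<open>m\<close>, but
    \<open>D\<close> halts on answer 1 and diverges on answer 0.\<close>
  then show False using D[of m] by (auto split: if_splits)
qed

end
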